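(* Let $1\le p\le\infty$ and let $\Lambda$ be a relatively-separated subset of $\mathbb{R}^d$. Then the Sjöstrand class $\mathcal{C}(\Lambda,\Lambda)$ is an inverse-closed subalgebra of $\mathcal{B}(\ell^p(\Lambda))$; that is, if $A\in\mathcal{C}(\Lambda,\Lambda)$ has a bounded inverse in $\mathcal{B}(\ell^p(\Lambda))$, then $A^{-1}\in\mathcal{C}(\Lambda,\Lambda)$.
   Context: A discrete subset $\Lambda$ of $\mathbb{R}^d$ is relatively-separated if $R(\Lambda)=\sup_{x\in\mathbb{R}^d}\sum_{\lambda\in\Lambda}\chi_{\lambda+[0,1)^d}(x)<\infty$, where $\chi_E$ is the characteristic function of $E$. The Sjöstrand class $\mathcal{C}(\Lambda,\Lambda)$ consists of all matrices $A=(a(\lambda,\lambda'))_{\lambda,\lambda'\in\Lambda}$ with $\|A\|_{\mathcal{C}}:=\sum_{k\in\mathbb{Z}^d}\sup_{\lambda,\lambda'\in\Lambda}|a(\lambda,\lambda')|\chi_{k+[0,1)^d}(\lambda-\lambda')<\infty$; such a matrix defines a bounded operator on $\ell^p(\Lambda)$ by $(Ac)(\lambda)=\sum_{\lambda'\in\Lambda}a(\lambda,\lambda')c(\lambda')$, and is identified with this operator. $\mathcal{B}(\ell^p(\Lambda))$ is the Banach algebra of all bounded operators on $\ell^p(\Lambda)$. A subalgebra $\mathcal{A}$ of a Banach algebra $\mathcal{B}$ is inverse-closed if, whenever $T\in\mathcal{A}$ has an inverse $T^{-1}$ belonging to $\mathcal{B}$, then $T^{-1}\in\mathcal{A}$.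 *)

theory Defs
  imports
    "HOL-Algebra.Module"
    "HOL-Algebra.Subrings"
    "HOL-Analysis.Analysis"
begin

definition unit_cube :: "(real ^ 'd) set" where
  "unit_cube = {x. \<forall>i. 0 \<le> x $ i \<and> x $ i < 1}"

definition integer_lattice :: "(real ^ 'd) set" where
  "integer_lattice = {k. \<forall>i. k $ i \<in> \<int>}"

definition relatively_separated :: "(real ^ 'd) set \<Rightarrow> bool" where
  "relatively_separated \<Lambda> \<longleftrightarrow>
     discrete \<Lambda> \<and>
     (SUP x. \<Sum>\<^sub>\<infinity>l\<in>\<Lambda>. indicator ((+) l ` unit_cube) x :: ennreal) < \<infinity>"

text \<open>
  A sequence indexed by \<open>\<Lambda>\<close> is represented by its extension by zero to the whole type, so sums
  and suprema over \<open>\<Lambda>\<close> may be taken over the whole type (which also avoids the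
  unspecified real supremum of the empty set).
\<close>

definition lp_norm :: "ennreal \<Rightarrow> ('a \<Rightarrow> complex) \<Rightarrow> real" where
  "lp_norm p c =
     (if p = \<infinity> then (SUP x. norm (c x))
      else (\<Sum>\<^sub>\<infinity>x. norm (c x) powr enn2real p) powr (1 / enn2real p))"

definition lp_space :: "ennreal \<Rightarrow> 'a set \<Rightarrow> ('a \<Rightarrow> complex) set" where
  "lp_space p \<Lambda> =
     {c. (\<forall>x. x \<notin> \<Lambda> \<longrightarrow> c x = 0) \<and>
         (if p = \<infinity> then bounded (range c)
          else (\<lambda>x. norm (c x) powr enn2real p) summable_on UNIV)}"

text \<open>
  Operators are extensional functions on \<open>lp_space p \<Lambda>\<close> (that is, \<open>undefined\<close> outside of it), so
  that equality of operators is equality of functions.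
\<close>

definition bounded_operators ::
    "ennreal \<Rightarrow> 'a set \<Rightarrow> (('a \<Rightarrow> complex) \<Rightarrow> ('a \<Rightarrow> complex)) set" where
  "bounded_operators p \<Lambda> =
     {T \<in> lp_space p \<Lambda> \<rightarrow>\<^sub>E lp_space p \<Lambda>.
        (\<forall>c\<in>lp_space p \<Lambda>. \<forall>c'\<in>lp_space p \<Lambda>. T (\<lambda>x. c x + c' x) = (\<lambda>x. T c x + T c' x)) \<and>
        (\<forall>z. \<forall>c\<in>lp_space p \<Lambda>. T (\<lambda>x. z * c x) = (\<lambda>x. z * T c x)) \<and>
        (\<exists>K. \<forall>c\<in>lp_space p \<Lambda>. lp_norm p (T c) \<le> K * lp_norm p c)}"

text \<open>
  The complex algebra \<open>\<B>(\<ell>\<^sup>p(\<Lambda>))\<close>, as a record carrying both ring operations and scalar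
  multiplication. (The locales \<open>module\<close> and \<open>algebra\<close> over this record type are not used.)
\<close>

definition operator_algebra ::
    "ennreal \<Rightarrow> 'a set \<Rightarrow> (complex, ('a \<Rightarrow> complex) \<Rightarrow> ('a \<Rightarrow> complex)) module" where
  "operator_algebra p \<Lambda> =
     \<lparr>carrier = bounded_operators p \<Lambda>,
      monoid.mult = (\<lambda>S T. compose (lp_space p \<Lambda>) S T),
      one = (\<lambda>c\<in>lp_space p \<Lambda>. c),
      zero = (\<lambda>c\<in>lp_space p \<Lambda>. \<lambda>x. 0),
      add = (\<lambda>S T. \<lambda>c\<in>lp_space p \<Lambda>. \<lambda>x. S c x + T c x),
      module.smult = (\<lambda>z T. \<lambda>c\<in>lp_space p \<Lambda>. \<lambda>x. z * T c x)\<rparr>"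

definition is_subalgebra :: "'b set \<Rightarrow> (complex, 'b) module \<Rightarrow> bool" where
  "is_subalgebra A B \<longleftrightarrow> subring A B \<and> (\<forall>z. \<forall>T\<in>A. z \<odot>\<^bsub>B\<^esub> T \<in> A)"

definition inverse_closed :: "'b set \<Rightarrow> (complex, 'b) module \<Rightarrow> bool" where
  "inverse_closed A B \<longleftrightarrow> (\<forall>T\<in>A. T \<in> Units B \<longrightarrow> inv\<^bsub>B\<^esub> T \<in> A)"

definition sjostrand_norm ::
    "(real ^ 'd) set \<Rightarrow> (real ^ 'd \<Rightarrow> real ^ 'd \<Rightarrow> complex) \<Rightarrow> ennreal" where
  "sjostrand_norm \<Lambda> a =
     (\<Sum>\<^sub>\<infinity>k\<in>integer_lattice. SUP (l, l')\<in>\<Lambda> \<times> \<Lambda>.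
        ennreal (norm (a l l')) * indicator ((+) k ` unit_cube) (l - l'))"

definition sjostrand_class ::
    "(real ^ 'd) set \<Rightarrow> (real ^ 'd \<Rightarrow> real ^ 'd \<Rightarrow> complex) set" where
  "sjostrand_class \<Lambda> =
     {a. (\<forall>l l'. (l, l') \<notin> \<Lambda> \<times> \<Lambda> \<longrightarrow> a l l' = 0) \<and> sjostrand_norm \<Lambda> a < \<infinity>}"

definition matrix_operator ::
    "ennreal \<Rightarrow> 'a set \<Rightarrow> ('a \<Rightarrow> 'a \<Rightarrow> complex) \<Rightarrow> ('a \<Rightarrow> complex) \<Rightarrow> ('a \<Rightarrow> complex)" where
  "matrix_operator p \<Lambda> a =
     (\<lambda>c\<in>lp_space p \<Lambda>. \<lambda>l. if l \<in> \<Lambda> then \<Sum>\<^sub>\<infinity>l'\<in>\<Lambda>. a l l' * c l' else 0)"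

definition sjostrand_operators ::
    "ennreal \<Rightarrow> (real ^ 'd) set \<Rightarrow> ((real ^ 'd \<Rightarrow> complex) \<Rightarrow> (real ^ 'd \<Rightarrow> complex)) set" where
  "sjostrand_operators p \<Lambda> = matrix_operator p \<Lambda> ` sjostrand_class \<Lambda>"

end

theory Submission
  imports Defs
begin

text \<open>
  Rounding the points of \<open>\<Lambda>\<close> to lattice points, a matrix is in the class iff its entries are
  dominated by \<open>h (g x - g y)\<close> for a summable \<open>h\<close> on the lattice, where the rounding map \<open>g\<close> has
  fibers of bounded size. Let \<open>A\<close> be such a matrix with bounded inverse, let \<open>c\<close> be the column of
  the inverse at \<open>y\<close>, so that \<open>A c\<close> is a unit vector, and let \<open>\<tau>\<^sub>k\<close> be a Lipschitz bump of width
  \<open>n\<close> around \<open>k\<close>. Applying the lower bound of \<open>A\<close> to \<open>\<tau>\<^sub>k c\<close> gives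
  \<open>\<parallel>\<tau>\<^sub>k c\<parallel> \<le> K \<parallel>\<tau>\<^sub>k A c\<parallel> + K \<parallel>[A, \<tau>\<^sub>k] c\<parallel>\<close>. The commutator has small entries, because bumps vary slowly
  and \<open>h\<close> is summable, and it only sees \<open>c\<close> near \<open>k\<close> up to the shifts weighted by \<open>h\<close>. Hence
  \<open>k \<mapsto> \<parallel>\<tau>\<^sub>k c\<parallel>\<close> is bounded by a finitely supported function plus a convolution of itself with a
  kernel of total mass at most one half once \<open>n\<close> is large. Iterating yields a summable bound, the
  same for all columns after translating by \<open>g y\<close>. The exponent \<open>p\<close> enters only through the norm.
\<close>

section \<open>Bounds on the \<open>\<ell>\<^sup>p\<close> norm\<close>

text \<open>If one of the points is 0, this reduces to \<open>v powr r \<le> v\<close> on the unit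
  interval; otherwise it is convexity of the power function.\<close>

lemma powr_convex_nonneg:
  fixes a b r u :: real
  assumes "1 \<le> r" "0 \<le> a" "0 \<le> b" "0 \<le> u" "u \<le> 1"
  shows "((1 - u) * a + u * b) powr r \<le> (1 - u) * a powr r + u * b powr r"
proof -
  have le: "v powr r \<le> v" if "0 \<le> v" "v \<le> 1" for v :: real
    using powr_mono'[of 1 r v] that assms(1) by (cases "v = 0") auto
  show ?thesis
  proof (cases "a = 0 \<or> b = 0")
    case True
    then show ?thesis
      using assms le[of u] le[of "1 - u"] by (auto simp: powr_mult mult_right_mono)
  next
    case False
    then show ?thesis
      using convex_onD[OF powr_convex[OF assms(1)], of u a b] assms by auto
  qed
qed

text \<open>
  \<open>lp_bound p t f\<close> expresses \<open>\<parallel>f\<parallel>\<^sub>p \<le> t\<close> through finite sums, hence without summability side conditions.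
\<close>

definition lp_bound :: "ennreal \<Rightarrow> real \<Rightarrow> ('a \<Rightarrow> real) \<Rightarrow> bool" where
  "lp_bound p t f \<longleftrightarrow> 0 \<le> t \<and> (\<forall>x. 0 \<le> f x) \<and>
     (if p = \<infinity> then \<forall>x. f x \<le> t
      else \<forall>F. finite F \<longrightarrow> (\<Sum>x\<in>F. f x powr enn2real p) \<le> t powr enn2real p)"

lemma lp_bound_nonneg: "lp_bound p t f \<Longrightarrow> 0 \<le> f x"
  and lp_bound_const_nonneg: "lp_bound p t f \<Longrightarrow> 0 \<le> t"
  by (auto simp: lp_bound_def)

lemma enn2real_ge_1: "1 \<le> p \<Longrightarrow> p \<noteq> \<infinity> \<Longrightarrow> 1 \<le> enn2real p"
  using enn2real_mono[of 1 p] by (simp add: less_top)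

lemma lp_bound_pointwise:
  assumes "1 \<le> p" "lp_bound p t f"
  shows "f x \<le> t"
proof (cases "p = \<infinity>")
  case True
  then show ?thesis using assms by (auto simp: lp_bound_def)
next
  case False
  then have "f x powr enn2real p \<le> t powr enn2real p"
    using assms by (auto simp: lp_bound_def dest: spec[of _ "{x}"])
  then show ?thesis
    using enn2real_ge_1[OF assms(1) False] assms(2)
    by (metis lp_bound_def not_less powr_less_mono2 less_le_trans zero_less_one)
qed

lemma lp_bound_mono:
  assumes "lp_bound p t f" "1 \<le> p" "\<And>x. 0 \<le> g x" "\<And>x. g x \<le> f x" "t \<le> t'"
  shows "lp_bound p t' g"
proof (cases "p = \<infinity>")
  case True
  then show ?thesis using assms unfolding lp_bound_def by (force intro: order_trans)
next
  case False
  note r = enn2real_ge_1[OF assms(2) False]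
  have "(\<Sum>x\<in>F. g x powr enn2real p) \<le> t' powr enn2real p" if "finite F" for F
  proof -
    have "(\<Sum>x\<in>F. g x powr enn2real p) \<le> (\<Sum>x\<in>F. f x powr enn2real p)"
      using assms r by (intro sum_mono powr_mono2) auto
    also have "\<dots> \<le> t powr enn2real p"
      using assms False that by (auto simp: lp_bound_def)
    also have "\<dots> \<le> t' powr enn2real p"
      using assms r by (intro powr_mono2) (auto simp: lp_bound_def)
    finally show ?thesis .
  qed
  then show ?thesis
    using assms False by (auto simp: lp_bound_def)
qed

lemma lp_bound_zero: "lp_bound p 0 (\<lambda>x. 0)"
  by (simp add: lp_bound_def)

lemma lp_bound_cmult:
  assumes "lp_bound p t f" "0 \<le> s"
  shows "lp_bound p (s * t) (\<lambda>x. s * f x)"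
proof (cases "p = \<infinity>")
  case True
  then show ?thesis using assms unfolding lp_bound_def by (auto intro: mult_left_mono)
next
  case False
  then show ?thesis
    using assms unfolding lp_bound_def
    by (auto simp: powr_mult sum_distrib_left[symmetric] intro: mult_left_mono)
qed

text \<open>Minkowski's inequality: \<open>f + g\<close> is \<open>s + t\<close> times a convex
  combination of \<open>f / s\<close> and \<open>g / t\<close>, whose power sums are at most 1, and
  convexity of the power is applied pointwise.\<close>

lemma lp_bound_add:
  assumes "1 \<le> p" "lp_bound p s f" "lp_bound p t g"
  shows "lp_bound p (s + t) (\<lambda>x. f x + g x)"
proof (cases "p = \<infinity>")
  case True
  then show ?thesis using assms(2,3) unfolding lp_bound_def by (auto intro: add_mono)
next
  case False
  note r = enn2real_ge_1[OF assms(1) False]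
  have nn: "0 \<le> s" "0 \<le> t" using assms by (auto simp: lp_bound_def)
  \<comment> \<open>A zero bound forces its function to vanish. These cases are split off because
    the normalization divides by \<open>s\<close> and \<open>t\<close>.\<close>
  consider "s = 0" | "t = 0" | "0 < s" "0 < t" using nn by linarith
  then show ?thesis
  proof cases
    case 1
    then have "f = (\<lambda>x. 0)"
      using lp_bound_pointwise[OF assms(1,2)] lp_bound_nonneg[OF assms(2)] by (intro ext antisym) auto
    then show ?thesis using 1 assms by simp
  next
    case 2
    then have "g = (\<lambda>x. 0)"
      using lp_bound_pointwise[OF assms(1,3)] lp_bound_nonneg[OF assms(3)] by (intro ext antisym) auto
    then show ?thesis using 2 assms by simp
  next
    case 3
    define r where "r = enn2real p"
    define u where "u = t / (s + t)"
    have u: "0 \<le> u" "u \<le> 1" "1 - u = s / (s + t)" using 3 by (auto simp: u_def field_simps)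
    have "(\<Sum>x\<in>F. (f x + g x) powr r) \<le> (s + t) powr r" if "finite F" for F
    proof -
      have le1: "(\<Sum>x\<in>F. (f x / s) powr r) \<le> 1" "(\<Sum>x\<in>F. (g x / t) powr r) \<le> 1"
        using assms(2,3) 3 False that
        by (auto simp: lp_bound_def r_def powr_divide sum_divide_distrib[symmetric])
      have "(f x + g x) powr r \<le>
        (s + t) powr r * ((1 - u) * (f x / s) powr r + u * (g x / t) powr r)" for x
      proof -
        have "(s + t) * (1 - u) = s" "(s + t) * u = t"
          using 3 unfolding u(3) by (auto simp: u_def)
        then have eq: "f x + g x = (s + t) * ((1 - u) * (f x / s) + u * (g x / t))"
          using 3 by (simp add: distrib_left mult.assoc[symmetric])
        have "(f x + g x) powr r = (s + t) powr r * ((1 - u) * (f x / s) + u * (g x / t)) powr r"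
          using 3 by (subst eq) (simp add: powr_mult)
        also have "\<dots> \<le> (s + t) powr r * ((1 - u) * (f x / s) powr r + u * (g x / t) powr r)"
          using 3 u assms(2,3) \<open>1 \<le> enn2real p\<close>
          by (intro mult_left_mono powr_convex_nonneg) (auto simp: lp_bound_def r_def)
        finally show ?thesis .
      qed
      then have "(\<Sum>x\<in>F. (f x + g x) powr r) \<le>
         (\<Sum>x\<in>F. (s + t) powr r * ((1 - u) * (f x / s) powr r + u * (g x / t) powr r))"
        by (rule sum_mono)
      also have "\<dots> = (s + t) powr r *
          ((1 - u) * (\<Sum>x\<in>F. (f x / s) powr r) + u * (\<Sum>x\<in>F. (g x / t) powr r))"
        by (simp add: sum_distrib_left[symmetric] sum.distrib)
      also have "\<dots> \<le> (s + t) powr r * ((1 - u) * 1 + u * 1)"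
        using le1 u by (intro mult_left_mono add_mono) auto
      finally show ?thesis by simp
    qed
    then show ?thesis
      using assms False by (auto simp: lp_bound_def r_def)
  qed
qed

lemma lp_bound_sum:
  assumes "1 \<le> p" "finite K" "\<And>k. k \<in> K \<Longrightarrow> lp_bound p (t k) (f k)"
  shows "lp_bound p (\<Sum>k\<in>K. t k) (\<lambda>x. \<Sum>k\<in>K. f k x)"
  using assms(2,3)
  by (induction K rule: finite_induct) (simp_all add: lp_bound_zero lp_bound_add[OF assms(1)])

text \<open>Minkowski's inequality for infinite families. Finite partial sums in \<open>k\<close>
  obey it with the total of \<open>t\<close>, and since only finitely many points are tested at a
  time, the bound survives the limit over finite subsets of \<open>K\<close>.\<close>

lemma lp_bound_infsum:
  assumes p: "1 \<le> p" and f: "\<And>k. k \<in> K \<Longrightarrow> lp_bound p (t k) (f k)" and t: "t summable_on K"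
  shows "(\<lambda>k. f k x) summable_on K" and "lp_bound p (\<Sum>\<^sub>\<infinity>k\<in>K. t k) (\<lambda>x. \<Sum>\<^sub>\<infinity>k\<in>K. f k x)"
proof -
  have sm: "(\<lambda>k. f k x) summable_on K" for x
    using lp_bound_nonneg[OF f] lp_bound_pointwise[OF p f]
    by (intro summable_on_comparison_test[OF t]) auto
  then show "(\<lambda>k. f k x) summable_on K" .
  let ?T = "\<Sum>\<^sub>\<infinity>k\<in>K. t k" and ?f = "\<lambda>x. \<Sum>\<^sub>\<infinity>k\<in>K. f k x"
  have part: "lp_bound p ?T (\<lambda>x. \<Sum>k\<in>K'. f k x)" if "finite K'" "K' \<subseteq> K" for K'
  proof (rule lp_bound_mono[OF lp_bound_sum[OF p that(1)] p])
    show "lp_bound p (t k) (f k)" if "k \<in> K'" for k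
      using f \<open>K' \<subseteq> K\<close> that by auto
    show "0 \<le> (\<Sum>k\<in>K'. f k x)" for x
      using that lp_bound_nonneg[OF f] by (intro sum_nonneg) auto
    show "(\<Sum>k\<in>K'. t k) \<le> ?T"
      using that lp_bound_const_nonneg[OF f] by (intro finite_sum_le_infsum t) auto
  qed auto
  have lim: "((\<lambda>K'. \<Sum>k\<in>K'. f k x) \<longlongrightarrow> ?f x) (finite_subsets_at_top K)" for x
    by (rule infsum_tendsto[OF sm])
  have T: "0 \<le> ?T" using lp_bound_const_nonneg[OF f] by (intro infsum_nonneg) auto
  have nn: "0 \<le> ?f x" for x using lp_bound_nonneg[OF f] by (intro infsum_nonneg) auto
  have ev: "eventually (\<lambda>K'. finite K' \<and> K' \<subseteq> K) (finite_subsets_at_top K)"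
    by (rule eventually_finite_subsets_at_top_weakI) auto
  show "lp_bound p ?T ?f"
  proof (cases "p = \<infinity>")
    case True
    have "?f x \<le> ?T" for x
    proof (rule tendsto_upperbound[OF lim eventually_mono[OF ev]])
      show "(\<Sum>k\<in>K'. f k x) \<le> ?T" if "finite K' \<and> K' \<subseteq> K" for K'
        using lp_bound_pointwise[OF p part] that by blast
    qed simp
    then show ?thesis using True T nn by (auto simp: lp_bound_def)
  next
    case False
    note r = enn2real_ge_1[OF p False]
    have "(\<Sum>x\<in>F. ?f x powr enn2real p) \<le> ?T powr enn2real p" if "finite F" for F
    proof (rule tendsto_upperbound[OF _ eventually_mono[OF ev]])
      show "((\<lambda>K'. \<Sum>x\<in>F. (\<Sum>k\<in>K'. f k x) powr enn2real p)
          \<longlongrightarrow> (\<Sum>x\<in>F. ?f x powr enn2real p)) (finite_subsets_at_top K)"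
        using r lp_bound_nonneg[OF f]
        by (intro tendsto_sum tendsto_powr' lim tendsto_const)
          (auto intro!: eventually_mono[OF ev] sum_nonneg)
    qed (use part that False in \<open>auto simp: lp_bound_def\<close>)
    then show ?thesis using False T nn by (auto simp: lp_bound_def)
  qed
qed

text \<open>For finite exponents this rests on the fact that a nonnegative series is summable iff
  its finite partial sums are bounded; the norm itself serves as the bound.\<close>

lemma lp_space_iff_lp_bound:
  assumes "1 \<le> p"
  shows "c \<in> lp_space p \<Lambda> \<longleftrightarrow>
    (\<forall>x. x \<notin> \<Lambda> \<longrightarrow> c x = 0) \<and> (\<exists>t. lp_bound p t (\<lambda>x. norm (c x)))"
proof (cases "p = \<infinity>")
  case True
  then show ?thesis
    unfolding lp_space_def lp_bound_def bounded_iff by (auto intro: order_trans[OF norm_ge_zero])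
next
  case False
  note r = enn2real_ge_1[OF assms False]
  have "(\<lambda>x. norm (c x) powr enn2real p) summable_on UNIV \<longleftrightarrow>
      (\<exists>t. lp_bound p t (\<lambda>x. norm (c x)))" (is "?S \<longleftrightarrow> _")
  proof
    assume ?S
    then have "(\<Sum>x\<in>F. norm (c x) powr enn2real p) \<le>
        ((\<Sum>\<^sub>\<infinity>x. norm (c x) powr enn2real p) powr (1 / enn2real p)) powr enn2real p" if "finite F" for F
      using finite_sum_le_infsum[OF \<open>?S\<close> that] r
      by (simp add: powr_powr infsum_nonneg)
    then have "lp_bound p ((\<Sum>\<^sub>\<infinity>x. norm (c x) powr enn2real p) powr (1 / enn2real p)) (\<lambda>x. norm (c x))"
      using False by (simp add: lp_bound_def)
    then show "\<exists>t. lp_bound p t (\<lambda>x. norm (c x))" ..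
  next
    assume "\<exists>t. lp_bound p t (\<lambda>x. norm (c x))"
    then show ?S
      using False by (auto simp: lp_bound_def intro!: nonneg_bdd_above_summable_on bdd_aboveI2)
  qed
  then show ?thesis using False by (auto simp: lp_space_def)
qed

lemma lp_bound_lp_norm:
  assumes "1 \<le> p" "c \<in> lp_space p \<Lambda>"
  shows "lp_bound p (lp_norm p c) (\<lambda>x. norm (c x))"
proof (cases "p = \<infinity>")
  case True
  then have "bdd_above (range (\<lambda>x. norm (c x)))"
    using assms by (force simp: lp_space_def bounded_iff bdd_above_def)
  then have "norm (c x) \<le> lp_norm p c" for x
    using cSUP_upper[OF UNIV_I, of "\<lambda>x. norm (c x)"] True by (simp add: lp_norm_def)
  then show ?thesis using True order_trans[OF norm_ge_zero] by (auto simp: lp_bound_def)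
next
  case False
  note r = enn2real_ge_1[OF assms(1) False]
  have S: "(\<lambda>x. norm (c x) powr enn2real p) summable_on UNIV"
    using assms False by (simp add: lp_space_def)
  have "(\<Sum>x\<in>F. norm (c x) powr enn2real p) \<le> lp_norm p c powr enn2real p" if "finite F" for F
    using finite_sum_le_infsum[OF S that] r False
    by (simp add: powr_powr infsum_nonneg lp_norm_def)
  then show ?thesis using False by (simp add: lp_bound_def lp_norm_def)
qed

lemma lp_norm_le:
  assumes "1 \<le> p" "lp_bound p t (\<lambda>x. norm (c x))"
  shows "lp_norm p c \<le> t"
proof (cases "p = \<infinity>")
  case True
  then show ?thesis using assms by (auto simp: lp_norm_def lp_bound_def intro: cSUP_least)
next
  case False
  note r = enn2real_ge_1[OF assms(1) False]
  have "(\<Sum>\<^sub>\<infinity>x. norm (c x) powr enn2real p) \<le> t powr enn2real p"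
    using assms False
    by (intro infsum_le_finite_sums nonneg_bdd_above_summable_on bdd_aboveI2)
      (auto simp: lp_bound_def)
  then have "(\<Sum>\<^sub>\<infinity>x. norm (c x) powr enn2real p) powr (1 / enn2real p)
      \<le> (t powr enn2real p) powr (1 / enn2real p)"
    using r by (intro powr_mono2 infsum_nonneg) auto
  also have "\<dots> = t" using r assms by (simp add: powr_powr lp_bound_def)
  finally show ?thesis using False by (simp add: lp_norm_def)
qed

lemma lp_norm_nonneg: "1 \<le> p \<Longrightarrow> c \<in> lp_space p \<Lambda> \<Longrightarrow> 0 \<le> lp_norm p c"
  using lp_bound_lp_norm lp_bound_const_nonneg by blast

lemma lp_bound_indicator: "lp_bound p 1 (\<lambda>x. if x = y then 1 else 0)"
proof -
  have "(\<Sum>x\<in>F. (if x = y then 1 else 0) powr enn2real p) \<le> 1" if "finite F" for F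
  proof -
    have "(\<Sum>x\<in>F. (if x = y then 1 else 0) powr enn2real p) \<le> (\<Sum>x\<in>F. if x = y then 1 else (0::real))"
      by (intro sum_mono) auto
    then show ?thesis using that by (simp add: sum.delta split: if_splits)
  qed
  then show ?thesis by (simp add: lp_bound_def)
qed

lemma summable_on_sup_bounded_mult:
  fixes h t :: "'a \<Rightarrow> real"
  assumes "h summable_on A" "\<And>x. x \<in> A \<Longrightarrow> 0 \<le> h x"
    and "\<And>x. x \<in> A \<Longrightarrow> 0 \<le> t x" "\<And>x. x \<in> A \<Longrightarrow> t x \<le> B"
  shows "(\<lambda>x. h x * t x) summable_on A"
  using assms
  by (intro summable_on_comparison_test[OF summable_on_cmult_left[OF assms(1), of B]])
    (auto intro: mult_left_mono)

text \<open>Lets both the membership and the norm bound of a newly built sequence be read off from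
  one pointwise majorant.\<close>

lemma lp_space_dominated:
  assumes "1 \<le> p" "lp_bound p t f" "\<And>x. norm (c x) \<le> f x" "\<And>x. x \<notin> \<Lambda> \<Longrightarrow> c x = 0"
  shows "c \<in> lp_space p \<Lambda>" "lp_norm p c \<le> t"
proof -
  have "lp_bound p t (\<lambda>x. norm (c x))"
    using lp_bound_mono[OF assms(2,1)] assms(3) by auto
  then show "c \<in> lp_space p \<Lambda>" "lp_norm p c \<le> t"
    using lp_space_iff_lp_bound[OF assms(1), of c \<Lambda>] lp_norm_le[OF assms(1)] assms(4) by auto
qed

lemma lp_space_add:
  assumes "1 \<le> p" "c \<in> lp_space p \<Lambda>" "c' \<in> lp_space p \<Lambda>"
  shows "(\<lambda>x. c x + c' x) \<in> lp_space p \<Lambda>"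
    and "lp_norm p (\<lambda>x. c x + c' x) \<le> lp_norm p c + lp_norm p c'"
  using lp_space_dominated[OF assms(1) lp_bound_add[OF assms(1)
        lp_bound_lp_norm[OF assms(1,2)] lp_bound_lp_norm[OF assms(1,3)]], of "\<lambda>x. c x + c' x" \<Lambda>]
    assms(2,3) by (auto simp: lp_space_def norm_triangle_ineq)

lemma lp_space_scale:
  assumes "1 \<le> p" "c \<in> lp_space p \<Lambda>"
  shows "(\<lambda>x. z * c x) \<in> lp_space p \<Lambda>" and "lp_norm p (\<lambda>x. z * c x) \<le> norm z * lp_norm p c"
  using lp_space_dominated[OF assms(1) lp_bound_cmult[OF lp_bound_lp_norm[OF assms] norm_ge_zero],
      of "\<lambda>x. z * c x" z \<Lambda>] assms(2) by (auto simp: lp_space_def norm_mult)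

text \<open>Cutting a sequence off by a bump function is a multiplication of this kind.\<close>

lemma lp_space_mult_le_1:
  assumes "1 \<le> p" "c \<in> lp_space p \<Lambda>" "\<And>x. norm (w x) \<le> 1"
  shows "(\<lambda>x. w x * c x) \<in> lp_space p \<Lambda>" and "lp_norm p (\<lambda>x. w x * c x) \<le> lp_norm p c"
proof -
  have "norm (w x * c x) \<le> norm (c x)" for x
    using assms(3)[of x] by (simp add: norm_mult mult_left_le_one_le)
  then show "(\<lambda>x. w x * c x) \<in> lp_space p \<Lambda>" "lp_norm p (\<lambda>x. w x * c x) \<le> lp_norm p c"
    using lp_space_dominated[OF assms(1) lp_bound_lp_norm[OF assms(1,2)], of "\<lambda>x. w x * c x" \<Lambda>]
      assms(2) by (auto simp: lp_space_def)
qed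

lemma lp_space_pointwise: "1 \<le> p \<Longrightarrow> c \<in> lp_space p \<Lambda> \<Longrightarrow> norm (c x) \<le> lp_norm p c"
  by (rule lp_bound_pointwise[OF _ lp_bound_lp_norm])

definition unit_vector :: "'a \<Rightarrow> 'a \<Rightarrow> complex" where
  "unit_vector y = (\<lambda>x. if x = y then 1 else 0)"

lemma unit_vector_lp:
  assumes "1 \<le> p" "y \<in> \<Lambda>"
  shows "unit_vector y \<in> lp_space p \<Lambda>" "lp_norm p (unit_vector y) \<le> 1"
proof -
  have "norm (unit_vector y x) \<le> (if x = y then 1 else 0)" for x
    by (simp add: unit_vector_def)
  moreover have "unit_vector y x = 0" if "x \<notin> \<Lambda>" for x
    using that assms(2) by (auto simp: unit_vector_def)
  ultimately show "unit_vector y \<in> lp_space p \<Lambda>" "lp_norm p (unit_vector y) \<le> 1"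
    using lp_space_dominated[OF assms(1) lp_bound_indicator[of p y]] by blast+
qed

section \<open>Index sets fibered over an abelian group, and Schur's test\<close>

locale fibered_set =
  fixes \<Lambda> :: "'a set" and g :: "'a \<Rightarrow> 'g::ab_group_add" and N :: nat
  assumes finite_fiber: "finite {x \<in> \<Lambda>. g x = m}"
    and card_fiber: "card {x \<in> \<Lambda>. g x = m} \<le> N"
begin

definition fiber :: "'g \<Rightarrow> 'a set" where
  "fiber m = {x \<in> \<Lambda>. g x = m}"

lemma fiber: "finite (fiber m)" "card (fiber m) \<le> N"
  using finite_fiber card_fiber by (auto simp: fiber_def)

lemma fiber_iff: "x \<in> fiber m \<longleftrightarrow> x \<in> \<Lambda> \<and> g x = m"
  by (simp add: fiber_def)

lemma fiber_sum_le: "(\<And>x. x \<in> fiber m \<Longrightarrow> f x \<le> B) \<Longrightarrow> 0 \<le> B \<Longrightarrow> sum f (fiber m) \<le> real N * B"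
  using sum_bounded_above[of "fiber m" f B] fiber(2)[of m]
    mult_right_mono[of "real (card (fiber m))" "real N" B] by simp

text \<open>Finitely many points lie in finitely many disjoint fibers, so every partial sum of
  \<open>X\<close> is at most the total of \<open>q\<close>. The bijection \<open>\<sigma>\<close>
  allows the fibers to be numbered relative to a fixed point, as \<open>k - m\<close> or
  \<open>k + m\<close>.\<close>

lemma summable_on_fibers:
  fixes X :: "'a \<Rightarrow> real"
  assumes X: "\<And>x. x \<in> \<Lambda> \<Longrightarrow> 0 \<le> X x" and \<sigma>: "bij \<sigma>"
    and q: "q summable_on UNIV" "\<And>m. sum X (fiber (\<sigma> m)) \<le> q m"
  shows "X summable_on \<Lambda>" "(\<Sum>\<^sub>\<infinity>x\<in>\<Lambda>. X x) \<le> (\<Sum>\<^sub>\<infinity>m. q m)"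
proof -
  have bd: "sum X F \<le> (\<Sum>\<^sub>\<infinity>m. q m)" if F: "finite F" "F \<subseteq> \<Lambda>" for F
  proof -
    let ?M = "inv_into UNIV \<sigma> ` g ` F"
    have "sum X F \<le> sum X (\<Union>m\<in>?M. fiber (\<sigma> m))"
    proof (rule sum_mono2)
      show "F \<subseteq> (\<Union>m\<in>?M. fiber (\<sigma> m))"
      proof
        fix x assume "x \<in> F"
        then have "x \<in> fiber (\<sigma> (inv_into UNIV \<sigma> (g x)))"
          using F surj_f_inv_f[OF bij_is_surj[OF \<sigma>]] by (auto simp: fiber_iff)
        then show "x \<in> (\<Union>m\<in>?M. fiber (\<sigma> m))" using \<open>x \<in> F\<close> by blast
      qed
    qed (use F fiber X in \<open>auto simp: fiber_iff\<close>)
    also have "\<dots> = (\<Sum>m\<in>?M. sum X (fiber (\<sigma> m)))"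
      using F fiber \<sigma>
      by (intro sum.UNION_disjoint) (auto simp: fiber_iff bij_def dest: injD)
    also have "\<dots> \<le> sum q ?M" by (intro sum_mono q)
    also have "\<dots> \<le> (\<Sum>\<^sub>\<infinity>m. q m)"
    proof (intro finite_sum_le_infsum q)
      \<comment> \<open>\<open>q\<close> inherits nonnegativity from the fiber sums that it
        dominates.\<close>
      show "0 \<le> q m" for m
        using q(2)[of m] sum_nonneg[of "fiber (\<sigma> m)" X] X by (force simp: fiber_iff)
    qed (use F in auto)
    finally show ?thesis .
  qed
  show "X summable_on \<Lambda>"
    using X bd by (intro nonneg_bdd_above_summable_on bdd_aboveI2) auto
  then show "(\<Sum>\<^sub>\<infinity>x\<in>\<Lambda>. X x) \<le> (\<Sum>\<^sub>\<infinity>m. q m)"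
    using bd by (intro infsum_le_finite_sums)
qed

text \<open>One diagonal of Schur's test. Each fiber sum has at most \<open>N\<close> terms, which
  costs one factor \<open>N\<close>; each \<open>y\<close> occurs in the sums of at most
  \<open>N\<close> points \<open>x\<close>, those over \<open>g y + m\<close>, which costs at most
  another.\<close>

lemma lp_bound_fiber_sum:
  assumes p: "1 \<le> p" and f: "lp_bound p t f"
  shows "lp_bound p (real N ^ 2 * t) (\<lambda>x. if x \<in> \<Lambda> then \<Sum>y\<in>fiber (g x - m). f y else 0)"
\<comment> \<open>For \<open>N = 0\<close> the set is empty. The other case relies on
  \<open>1 \<le> N\<close> when it estimates \<open>real N\<close> by its power.\<close>
proof (cases "N = 0 \<or> p = \<infinity>")
  case True
  have t: "0 \<le> t" using f by (simp add: lp_bound_def)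
  have "(\<Sum>y\<in>fiber (g x - m). f y) \<le> (real N)\<^sup>2 * t" for x
  proof -
    have "(\<Sum>y\<in>fiber (g x - m). f y) \<le> real N * t"
      using lp_bound_pointwise[OF p f] t by (intro fiber_sum_le)
    also have "\<dots> \<le> (real N)\<^sup>2 * t"
      using t by (intro mult_right_mono) (cases N; auto simp: power2_eq_square)
    finally show ?thesis .
  qed
  moreover have "\<Lambda> = {}" if "N = 0"
    using that fiber(2) fiber(1) by (force simp: fiber_iff)
  ultimately show ?thesis
    using True t lp_bound_nonneg[OF f] by (auto simp: lp_bound_def intro: sum_nonneg)
next
  case False
  define r where "r = enn2real p"
  have r: "1 \<le> r" using enn2real_ge_1 p False by (simp add: r_def)
  have t: "0 \<le> t" and f0: "\<And>x. 0 \<le> f x" using f by (auto simp: lp_bound_def)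
  define S where "S x = (if x \<in> \<Lambda> then \<Sum>y\<in>fiber (g x - m). f y else 0)" for x
  \<comment> \<open>Comparing all terms with the largest one is crude, but it turns the power of a
    sum into a sum of powers, and a constant depending only on \<open>N\<close> and the exponent is
    harmless.\<close>
  have 1: "(\<Sum>y\<in>fiber k. f y) powr r \<le> real N powr r * (\<Sum>y\<in>fiber k. f y powr r)" for k
  proof (cases "fiber k = {}")
    case True
    then show ?thesis using r by simp
  next
    case False
    obtain y where y: "y \<in> fiber k" "\<And>z. z \<in> fiber k \<Longrightarrow> f z \<le> f y"
    proof -
      have "Max (f ` fiber k) \<in> f ` fiber k" using False fiber(1) by (intro Max_in) auto
      then obtain y where "y \<in> fiber k" "f y = Max (f ` fiber k)" by force
      then show ?thesis using that[of y] fiber(1) by auto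
    qed
    have "(\<Sum>y\<in>fiber k. f y) powr r \<le> (real N * f y) powr r"
      using r f0 y by (intro powr_mono2 fiber_sum_le sum_nonneg) auto
    also have "\<dots> = real N powr r * f y powr r" using f0 by (simp add: powr_mult)
    also have "\<dots> \<le> real N powr r * (\<Sum>y\<in>fiber k. f y powr r)"
      using y fiber(1) by (intro mult_left_mono member_le_sum) auto
    finally show ?thesis .
  qed
  have "(\<Sum>x\<in>F. S x powr r) \<le> ((real N)\<^sup>2 * t) powr r" if F: "finite F" for F
  proof -
    let ?F = "F \<inter> \<Lambda>" and ?F' = "\<Union>x\<in>F. fiber (g x - m)"
    have F': "finite ?F'" using F fiber by auto
    have "(\<Sum>x\<in>?F. \<Sum>y\<in>fiber (g x - m). f y powr r) =
        (\<Sum>x\<in>?F. \<Sum>y\<in>?F'. if y \<in> fiber (g x - m) then f y powr r else 0)"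
      using F F' by (intro sum.cong refl sum.mono_neutral_cong_left) auto
    also have "\<dots> = (\<Sum>y\<in>?F'. \<Sum>x\<in>?F. if y \<in> fiber (g x - m) then f y powr r else 0)"
      by (rule sum.swap)
    also have "\<dots> \<le> (\<Sum>y\<in>?F'. real N * f y powr r)"
    proof (rule sum_mono)
      fix y assume "y \<in> ?F'"
      have "(\<Sum>x\<in>?F. if y \<in> fiber (g x - m) then f y powr r else 0)
          = (\<Sum>x\<in>{x \<in> ?F. y \<in> fiber (g x - m)}. f y powr r)"
        using F by (intro sum.inter_filter[symmetric]) auto
      \<comment> \<open>After the exchange of sums, the points \<open>x\<close> that see a given
        \<open>y\<close> all lie in a single fiber.\<close>
      also have "\<dots> \<le> (\<Sum>x\<in>fiber (g y + m). f y powr r)"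
        using fiber by (intro sum_mono2) (auto simp: fiber_iff)
      also have "\<dots> \<le> real N * f y powr r" by (intro fiber_sum_le) auto
      finally show "(\<Sum>x\<in>?F. if y \<in> fiber (g x - m) then f y powr r else 0) \<le> real N * f y powr r" .
    qed
    also have "\<dots> = real N * (\<Sum>y\<in>?F'. f y powr r)" by (simp add: sum_distrib_left)
    also have "\<dots> \<le> real N powr r * t powr r"
    proof (rule mult_mono)
      show "real N \<le> real N powr r"
        using False r powr_mono[of 1 r "real N"] by simp
      show "(\<Sum>y\<in>?F'. f y powr r) \<le> t powr r"
        using f F' False unfolding lp_bound_def r_def by presburger
    qed (auto intro: sum_nonneg)
    finally have inner: "(\<Sum>x\<in>?F. \<Sum>y\<in>fiber (g x - m). f y powr r) \<le> real N powr r * t powr r" .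
    have "(\<Sum>x\<in>F. S x powr r) = (\<Sum>x\<in>?F. S x powr r)"
      using F r by (intro sum.mono_neutral_right) (auto simp: S_def)
    also have "\<dots> \<le> (\<Sum>x\<in>?F. real N powr r * (\<Sum>y\<in>fiber (g x - m). f y powr r))"
      by (intro sum_mono) (auto simp: S_def 1)
    also have "\<dots> = real N powr r * (\<Sum>x\<in>?F. \<Sum>y\<in>fiber (g x - m). f y powr r)"
      by (rule sum_distrib_left[symmetric])
    also have "\<dots> \<le> real N powr r * (real N powr r * t powr r)"
      by (intro mult_left_mono inner) simp
    finally have "(\<Sum>x\<in>F. S x powr r) \<le> real N powr r * (real N powr r * t powr r)" .
    then show ?thesis using t by (simp add: powr_mult power2_eq_square)
  qed
  then show ?thesis
    using t f0 False by (auto simp: lp_bound_def r_def S_def intro: sum_nonneg)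
qed

text \<open>Each row is split into the diagonals \<open>g x - g y = m\<close>. Diagonal
  \<open>m\<close> contributes a fiber sum of \<open>F m\<close> scaled by \<open>h m\<close>, and
  Minkowski's inequality adds the diagonals up. The majorant \<open>F m\<close> may vary with the
  diagonal, because in the commutator estimate the relevant cutoffs of the vector move with
  \<open>m\<close>.\<close>

lemma schur_test:
  assumes p: "1 \<le> p" and h: "\<And>m. 0 \<le> h m" "(\<lambda>m. h m * t m) summable_on UNIV"
    and F: "\<And>m. lp_bound p (t m) (F m)"
    and X: "\<And>x y. x \<in> \<Lambda> \<Longrightarrow> y \<in> \<Lambda> \<Longrightarrow> 0 \<le> X x y"
      "\<And>x y. x \<in> \<Lambda> \<Longrightarrow> y \<in> \<Lambda> \<Longrightarrow> X x y \<le> h (g x - g y) * F (g x - g y) y"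
  shows "\<And>x. x \<in> \<Lambda> \<Longrightarrow> X x summable_on \<Lambda>"
    and "lp_bound p (real N ^ 2 * (\<Sum>\<^sub>\<infinity>m. h m * t m)) (\<lambda>x. if x \<in> \<Lambda> then \<Sum>\<^sub>\<infinity>y\<in>\<Lambda>. X x y else 0)"
proof -
  define G where "G m x = h m * (if x \<in> \<Lambda> then \<Sum>y\<in>fiber (g x - m). F m y else 0)" for m x
  have G: "lp_bound p (h m * (real N ^ 2 * t m)) (G m)" for m
    unfolding G_def by (intro lp_bound_cmult lp_bound_fiber_sum p F h)
  have sm: "(\<lambda>m. h m * ((real N)\<^sup>2 * t m)) summable_on UNIV"
    unfolding mult.left_commute[of "h _"] by (rule summable_on_cmult_right[OF h(2)])
  note inf = lp_bound_infsum[OF p G sm]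
  have bij: "bij (\<lambda>m. k - m)" for k :: 'g
    by (rule involuntory_imp_bij) simp
  have le: "sum (X x) (fiber (g x - m)) \<le> G m x" if "x \<in> \<Lambda>" for x m
  proof -
    have "sum (X x) (fiber (g x - m)) \<le> (\<Sum>y\<in>fiber (g x - m). h m * F m y)"
      using X(2) that by (intro sum_mono) (force simp: fiber_iff)
    then show ?thesis using that by (simp add: G_def sum_distrib_left)
  qed
  show "X x summable_on \<Lambda>" if "x \<in> \<Lambda>" for x
    using summable_on_fibers(1)[OF X(1) bij inf(1) le] that by blast
  have "(\<Sum>\<^sub>\<infinity>y\<in>\<Lambda>. X x y) \<le> (\<Sum>\<^sub>\<infinity>m. G m x)" if "x \<in> \<Lambda>" for x
    using summable_on_fibers(2)[OF X(1) bij inf(1) le] that by blast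
  moreover have "(\<Sum>\<^sub>\<infinity>m. h m * ((real N)\<^sup>2 * t m)) = real N ^ 2 * (\<Sum>\<^sub>\<infinity>m. h m * t m)"
    unfolding mult.left_commute[of "h _"] by (rule infsum_cmult_right')
  moreover have "(\<Sum>\<^sub>\<infinity>m. G m x) = 0" if "x \<notin> \<Lambda>" for x
    using that by (simp add: G_def)
  ultimately show "lp_bound p (real N ^ 2 * (\<Sum>\<^sub>\<infinity>m. h m * t m))
      (\<lambda>x. if x \<in> \<Lambda> then \<Sum>\<^sub>\<infinity>y\<in>\<Lambda>. X x y else 0)"
    using X(1) by (intro lp_bound_mono[OF inf(2) p]) (auto intro!: infsum_nonneg)
qed

end

section \<open>The algebra of dominated matrices\<close>

lemma bij_minus_left: "bij (\<lambda>m. k - m)" for k :: "'g::ab_group_add"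
  by (rule involuntory_imp_bij) simp

lemma bij_plus_left: "bij (\<lambda>m. k + m)" for k :: "'g::ab_group_add"
  by (rule o_bij[of "\<lambda>m. m - k"]) (auto simp: fun_eq_iff)

text \<open>Tonelli's theorem for a superposition of functions \<open>w m\<close> of equal mass
  \<open>B\<close> with weights \<open>\<epsilon> m\<close>: the masses multiply.\<close>

lemma kernel_has_sum:
  fixes \<epsilon> :: "'s \<Rightarrow> real" and w :: "'s \<Rightarrow> 'k \<Rightarrow> real"
  assumes "\<epsilon> summable_on UNIV" "\<And>m. 0 \<le> \<epsilon> m" "\<And>m k. 0 \<le> w m k"
    and w: "\<And>m. (w m has_sum B) UNIV"
  shows "(\<lambda>m. \<epsilon> m * w m k) summable_on UNIV"
    and "((\<lambda>k. \<Sum>\<^sub>\<infinity>m. \<epsilon> m * w m k) has_sum (\<Sum>\<^sub>\<infinity>m. \<epsilon> m) * B) UNIV"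
proof -
  let ?f = "\<lambda>(m, k). \<epsilon> m * w m k"
  have row: "((\<lambda>k. ?f (m, k)) has_sum \<epsilon> m * B) UNIV" for m
    using has_sum_cmult_right[OF w, of "\<epsilon> m" m] by simp
  have rows: "((\<lambda>m. \<epsilon> m * B) has_sum (\<Sum>\<^sub>\<infinity>m. \<epsilon> m) * B) UNIV"
    using assms(1) by (intro has_sum_cmult_left has_sum_infsum)
  have "?f summable_on UNIV \<times> UNIV"
    by (rule summable_on_SigmaI[OF row has_sum_imp_summable[OF rows]]) (use assms(2,3) in auto)
  then have "(?f has_sum (\<Sum>\<^sub>\<infinity>m. \<epsilon> m) * B) (UNIV \<times> UNIV)"
    by (intro has_sum_SigmaI[OF row rows])
  then have "((\<lambda>(k, m). \<epsilon> m * w m k) has_sum (\<Sum>\<^sub>\<infinity>m. \<epsilon> m) * B) (UNIV \<times> UNIV)"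
    by (subst (asm) has_sum_swap) simp
  note S = this
  show col: "(\<lambda>m. \<epsilon> m * w m k) summable_on UNIV" for k
    using summable_on_SigmaD1[OF has_sum_imp_summable[OF S], of k] by simp
  show "((\<lambda>k. \<Sum>\<^sub>\<infinity>m. \<epsilon> m * w m k) has_sum (\<Sum>\<^sub>\<infinity>m. \<epsilon> m) * B) UNIV"
    by (rule has_sum_SigmaD[OF S]) (simp add: has_sum_infsum[OF col])
qed

text \<open>A convolution is the superposition, with weights \<open>h' j\<close>, of the translates
  of \<open>h\<close> by \<open>j\<close>, all of which have the same total.\<close>

lemma summable_on_convolution:
  fixes h h' :: "'g::ab_group_add \<Rightarrow> real"
  assumes "h summable_on UNIV" "h' summable_on UNIV" "\<And>m. 0 \<le> h m" "\<And>m. 0 \<le> h' m"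
  shows "(\<lambda>j. h (m - j) * h' j) summable_on UNIV"
    and "(\<lambda>m. \<Sum>\<^sub>\<infinity>j. h (m - j) * h' j) summable_on UNIV"
proof -
  have shift: "((\<lambda>m. h (m - j)) has_sum (\<Sum>\<^sub>\<infinity>m. h m)) UNIV" for j
    using has_sum_reindex_bij_betw[OF bij_plus_left[of "- j"], of h] assms(1) by simp
  note K = kernel_has_sum[where w = "\<lambda>j m. h (m - j)", OF assms(2,4,3) shift]
  show "(\<lambda>j. h (m - j) * h' j) summable_on UNIV"
    using K(1)[of m] by (simp only: mult.commute[of "h _"])
  show "(\<lambda>m. \<Sum>\<^sub>\<infinity>j. h (m - j) * h' j) summable_on UNIV"
    using has_sum_imp_summable[OF K(2)] by (simp only: mult.commute[of "h _"])
qed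

section \<open>Action and product of dominated matrices\<close>

context fibered_set
begin

text \<open>The majorant is a witness in place of the suprema over diagonals, so bounds can be added
  and convolved directly. Entries with an index outside \<open>\<Lambda>\<close> are left free
  because \<open>matrix_operator\<close> never reads them.\<close>

definition dominated :: "('a \<Rightarrow> 'a \<Rightarrow> complex) \<Rightarrow> ('g \<Rightarrow> real) \<Rightarrow> bool" where
  "dominated a h \<longleftrightarrow> (\<forall>m. 0 \<le> h m) \<and> h summable_on UNIV \<and>
     (\<forall>x\<in>\<Lambda>. \<forall>y\<in>\<Lambda>. norm (a x y) \<le> h (g x - g y))"

definition matrix_mult :: "('a \<Rightarrow> 'a \<Rightarrow> complex) \<Rightarrow> ('a \<Rightarrow> 'a \<Rightarrow> complex) \<Rightarrow> 'a \<Rightarrow> 'a \<Rightarrow> complex" where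
  "matrix_mult a b x z = (if x \<in> \<Lambda> \<and> z \<in> \<Lambda> then \<Sum>\<^sub>\<infinity>y\<in>\<Lambda>. a x y * b y z else 0)"

lemma dominatedD:
  assumes "dominated a h"
  shows "0 \<le> h m" "h summable_on UNIV" "x \<in> \<Lambda> \<Longrightarrow> y \<in> \<Lambda> \<Longrightarrow> norm (a x y) \<le> h (g x - g y)"
  using assms by (auto simp: dominated_def)

lemma dominated_row_summable:
  assumes "dominated a h" "x \<in> \<Lambda>"
  shows "(\<lambda>y. norm (a x y)) summable_on \<Lambda>"
proof (rule summable_on_fibers(1)[OF _ bij_minus_left[of "g x"]])
  show "(\<lambda>m. real N * h m) summable_on UNIV"
    using assms by (auto simp: dominated_def intro: summable_on_cmult_right)
  show "(\<Sum>y\<in>fiber (g x - m). norm (a x y)) \<le> real N * h m" for m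
    using assms by (intro fiber_sum_le) (force simp: dominated_def fiber_iff)+
qed simp

text \<open>Schur's test with the same vector \<open>norm (c y)\<close> on every diagonal. Stating
  the bound for the sums of absolute values also gives the absolute convergence that later
  rearrangements rely on.\<close>

lemma dominated_apply:
  assumes p: "1 \<le> p" and a: "dominated a h" and c: "c \<in> lp_space p \<Lambda>"
  shows "x \<in> \<Lambda> \<Longrightarrow> (\<lambda>y. norm (a x y * c y)) summable_on \<Lambda>"
    and "lp_bound p ((real N)\<^sup>2 * (\<Sum>\<^sub>\<infinity>m. h m) * lp_norm p c)
      (\<lambda>x. if x \<in> \<Lambda> then \<Sum>\<^sub>\<infinity>y\<in>\<Lambda>. norm (a x y * c y) else 0)"
    and "matrix_operator p \<Lambda> a c \<in> lp_space p \<Lambda>"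
    and "lp_norm p (matrix_operator p \<Lambda> a c) \<le> (real N)\<^sup>2 * (\<Sum>\<^sub>\<infinity>m. h m) * lp_norm p c"
proof -
  note h = dominatedD[OF a]
  have sm: "(\<lambda>m. h m * lp_norm p c) summable_on UNIV"
    using h(2) by (rule summable_on_cmult_left)
  have le: "norm (a x y * c y) \<le> h (g x - g y) * norm (c y)" if "x \<in> \<Lambda>" "y \<in> \<Lambda>" for x y
    using h(3)[OF that] by (simp add: norm_mult mult_right_mono)
  note schur = schur_test[OF p h(1) sm lp_bound_lp_norm[OF p c], of "\<lambda>x y. norm (a x y * c y)"]
  show row: "(\<lambda>y. norm (a x y * c y)) summable_on \<Lambda>" if "x \<in> \<Lambda>" for x
    using schur(1)[OF _ le that] by simp
  have "(\<Sum>\<^sub>\<infinity>m. h m * lp_norm p c) = (\<Sum>\<^sub>\<infinity>m. h m) * lp_norm p c"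
    by (rule infsum_cmult_left')
  then show bd: "lp_bound p ((real N)\<^sup>2 * (\<Sum>\<^sub>\<infinity>m. h m) * lp_norm p c)
      (\<lambda>x. if x \<in> \<Lambda> then \<Sum>\<^sub>\<infinity>y\<in>\<Lambda>. norm (a x y * c y) else 0)"
    using schur(2)[OF _ le] by (simp add: mult.assoc)
  have "norm (matrix_operator p \<Lambda> a c x) \<le> (if x \<in> \<Lambda> then \<Sum>\<^sub>\<infinity>y\<in>\<Lambda>. norm (a x y * c y) else 0)" for x
    using c norm_infsum_bound[OF row] by (simp add: matrix_operator_def)
  then show "matrix_operator p \<Lambda> a c \<in> lp_space p \<Lambda>"
    "lp_norm p (matrix_operator p \<Lambda> a c) \<le> (real N)\<^sup>2 * (\<Sum>\<^sub>\<infinity>m. h m) * lp_norm p c"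
    using lp_space_dominated[OF p bd, of "matrix_operator p \<Lambda> a c" \<Lambda>] c
    by (auto simp: matrix_operator_def)
qed

lemma matrix_operator_bounded:
  assumes p: "1 \<le> p" and a: "dominated a h"
  shows "matrix_operator p \<Lambda> a \<in> bounded_operators p \<Lambda>"
proof -
  have sm: "(\<lambda>y. a x y * c y) summable_on \<Lambda>" if "x \<in> \<Lambda>" "c \<in> lp_space p \<Lambda>" for x c
    using dominated_apply(1)[OF p a that(2,1)] by (rule abs_summable_summable)
  have "matrix_operator p \<Lambda> a \<in> lp_space p \<Lambda> \<rightarrow>\<^sub>E lp_space p \<Lambda>"
    using dominated_apply(3)[OF p a] by (auto simp: matrix_operator_def)
  moreover have "matrix_operator p \<Lambda> a (\<lambda>x. c x + c' x) =
      (\<lambda>x. matrix_operator p \<Lambda> a c x + matrix_operator p \<Lambda> a c' x)"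
    if "c \<in> lp_space p \<Lambda>" "c' \<in> lp_space p \<Lambda>" for c c'
    using that lp_space_add(1)[OF p that]
    by (auto simp: matrix_operator_def fun_eq_iff distrib_left infsum_add sm)
  moreover have "matrix_operator p \<Lambda> a (\<lambda>x. z * c x) = (\<lambda>x. z * matrix_operator p \<Lambda> a c x)"
    if "c \<in> lp_space p \<Lambda>" for c z
  proof -
    have "(\<Sum>\<^sub>\<infinity>y\<in>\<Lambda>. a x y * (z * c y)) = z * (\<Sum>\<^sub>\<infinity>y\<in>\<Lambda>. a x y * c y)" for x
      unfolding mult.left_commute[of "a _ _"] by (rule infsum_cmult_right')
    then show ?thesis
      using that lp_space_scale(1)[OF p that] by (auto simp: matrix_operator_def fun_eq_iff)
  qed
  moreover have "\<exists>K. \<forall>c\<in>lp_space p \<Lambda>. lp_norm p (matrix_operator p \<Lambda> a c) \<le> K * lp_norm p c"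
    using dominated_apply(4)[OF p a] by blast
  ultimately show ?thesis by (auto simp: bounded_operators_def)
qed

text \<open>The intermediate points \<open>y\<close> are grouped by \<open>j = g y - g z\<close>.
  The first factor is then controlled at \<open>g x - g z - j\<close>, so a convolution of the
  majorants appears, with a factor \<open>N\<close> for the size of the fibers.\<close>

lemma dominated_mult:
  assumes a: "dominated a h" and b: "dominated b h'"
  shows "dominated (matrix_mult a b) (\<lambda>m. real N * (\<Sum>\<^sub>\<infinity>j. h (m - j) * h' j))"
proof -
  note h = dominatedD[OF a] and h' = dominatedD[OF b]
  note conv = summable_on_convolution[OF h(2) h'(2) h(1) h'(1)]
  have "norm (matrix_mult a b x z) \<le> real N * (\<Sum>\<^sub>\<infinity>j. h (g x - g z - j) * h' j)"
    if xz: "x \<in> \<Lambda>" "z \<in> \<Lambda>" for x z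
  proof -
    have le: "(\<Sum>y\<in>fiber (g z + j). norm (a x y * b y z)) \<le> real N * (h (g x - g z - j) * h' j)" for j
    proof (rule fiber_sum_le)
      fix y assume "y \<in> fiber (g z + j)"
      then have y: "y \<in> \<Lambda>" "g y = g z + j" by (auto simp: fiber_iff)
      then show "norm (a x y * b y z) \<le> h (g x - g z - j) * h' j"
        using h(3)[OF xz(1) y(1)] h'(3)[OF y(1) xz(2)] h(1)
        unfolding norm_mult by (intro mult_mono) (auto simp: algebra_simps)
    qed (use h h' in auto)
    note fib = summable_on_fibers[OF _ bij_plus_left summable_on_cmult_right[OF conv(1)] le]
    have "norm (matrix_mult a b x z) \<le> (\<Sum>\<^sub>\<infinity>y\<in>\<Lambda>. norm (a x y * b y z))"
      using xz norm_infsum_bound[OF fib(1)] by (simp add: matrix_mult_def)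
    also have "\<dots> \<le> (\<Sum>\<^sub>\<infinity>j. real N * (h (g x - g z - j) * h' j))"
      using fib(2) by simp
    also have "\<dots> = real N * (\<Sum>\<^sub>\<infinity>j. h (g x - g z - j) * h' j)" by (rule infsum_cmult_right')
    finally show ?thesis .
  qed
  then show ?thesis
    using h(1) h'(1) conv(2)
    by (auto simp: dominated_def intro!: summable_on_cmult_right mult_nonneg_nonneg infsum_nonneg)
qed

text \<open>Fubini for the double series over \<open>y\<close> and \<open>z\<close>. It converges
  absolutely: the inner sums of absolute values are bounded uniformly in \<open>y\<close> by the
  norm estimate for \<open>b\<close>, and the row of \<open>a\<close> at \<open>x\<close> is
  summable.\<close>

lemma matrix_operator_mult:
  assumes p: "1 \<le> p" and a: "dominated a h" and b: "dominated b h'" and c: "c \<in> lp_space p \<Lambda>"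
  shows "matrix_operator p \<Lambda> a (matrix_operator p \<Lambda> b c) = matrix_operator p \<Lambda> (matrix_mult a b) c"
proof (rule ext)
  fix x
  note bc = dominated_apply[OF p b c]
  have abc: "matrix_operator p \<Lambda> a (matrix_operator p \<Lambda> b c) x =
      (if x \<in> \<Lambda> then \<Sum>\<^sub>\<infinity>y\<in>\<Lambda>. a x y * matrix_operator p \<Lambda> b c y else 0)"
    using bc(3) unfolding matrix_operator_def[of p \<Lambda> a] by simp
  show "matrix_operator p \<Lambda> a (matrix_operator p \<Lambda> b c) x = matrix_operator p \<Lambda> (matrix_mult a b) c x"
  proof (cases "x \<in> \<Lambda>")
    case True
    let ?B = "(real N)\<^sup>2 * (\<Sum>\<^sub>\<infinity>m. h' m) * lp_norm p c"
    have "(\<lambda>(y, z). norm (a x y * (b y z * c z))) summable_on \<Lambda> \<times> \<Lambda>"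
    proof (rule summable_on_SigmaI)
      fix y assume y: "y \<in> \<Lambda>"
      show "((\<lambda>z. case (y, z) of (y, z) \<Rightarrow> norm (a x y * (b y z * c z))) has_sum
          norm (a x y) * (\<Sum>\<^sub>\<infinity>z\<in>\<Lambda>. norm (b y z * c z))) \<Lambda>"
        unfolding case_prod_conv norm_mult[of "a x y"]
        by (intro has_sum_cmult_right has_sum_infsum bc(1) y)
    next
      show "(\<lambda>y. norm (a x y) * (\<Sum>\<^sub>\<infinity>z\<in>\<Lambda>. norm (b y z * c z))) summable_on \<Lambda>"
      proof (rule summable_on_sup_bounded_mult)
        show "(\<Sum>\<^sub>\<infinity>z\<in>\<Lambda>. norm (b y z * c z)) \<le> ?B" if "y \<in> \<Lambda>" for y
          using lp_bound_pointwise[OF p bc(2), of y] that by simp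
      qed (auto intro: dominated_row_summable[OF a True] infsum_nonneg)
    qed auto
    then have "(\<lambda>q. norm (case q of (y, z) \<Rightarrow> a x y * (b y z * c z))) summable_on \<Lambda> \<times> \<Lambda>"
      by (simp add: case_prod_unfold)
    then have "(\<lambda>(y, z). a x y * (b y z * c z)) summable_on \<Lambda> \<times> \<Lambda>"
      by (rule abs_summable_summable)
    then have swap: "(\<Sum>\<^sub>\<infinity>y\<in>\<Lambda>. \<Sum>\<^sub>\<infinity>z\<in>\<Lambda>. a x y * (b y z * c z)) =
        (\<Sum>\<^sub>\<infinity>z\<in>\<Lambda>. \<Sum>\<^sub>\<infinity>y\<in>\<Lambda>. a x y * (b y z * c z))"
      by (rule infsum_swap_banach)
    have "matrix_operator p \<Lambda> a (matrix_operator p \<Lambda> b c) x =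
        (\<Sum>\<^sub>\<infinity>y\<in>\<Lambda>. a x y * (\<Sum>\<^sub>\<infinity>z\<in>\<Lambda>. b y z * c z))"
      unfolding abc using True c by (auto simp: matrix_operator_def intro!: infsum_cong)
    also have "\<dots> = (\<Sum>\<^sub>\<infinity>z\<in>\<Lambda>. (\<Sum>\<^sub>\<infinity>y\<in>\<Lambda>. a x y * b y z) * c z)"
      unfolding infsum_cmult_right'[symmetric] infsum_cmult_left'[symmetric] swap
      by (simp add: mult.assoc)
    also have "\<dots> = matrix_operator p \<Lambda> (matrix_mult a b) c x"
      using True c by (auto simp: matrix_operator_def matrix_mult_def intro!: infsum_cong)
    finally show ?thesis .
  next
    case False
    then show ?thesis unfolding abc using c by (simp add: matrix_operator_def)
  qed
qed

lemma dominated_add: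
  assumes "dominated a h" "dominated b h'"
  shows "dominated (\<lambda>x y. a x y + b x y) (\<lambda>m. h m + h' m)"
  using assms unfolding dominated_def
  by (auto intro!: summable_on_add add_mono order_trans[OF norm_triangle_ineq])

lemma dominated_scale: "dominated a h \<Longrightarrow> dominated (\<lambda>x y. z * a x y) (\<lambda>m. norm z * h m)"
  unfolding dominated_def
  by (auto intro!: summable_on_cmult_right mult_left_mono simp: norm_mult)

lemma matrix_operator_add:
  assumes p: "1 \<le> p" and a: "dominated a h" and b: "dominated b h'" and c: "c \<in> lp_space p \<Lambda>"
  shows "matrix_operator p \<Lambda> (\<lambda>x y. a x y + b x y) c =
    (\<lambda>x. matrix_operator p \<Lambda> a c x + matrix_operator p \<Lambda> b c x)"
  using c abs_summable_summable[OF dominated_apply(1)[OF p a c]]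
    abs_summable_summable[OF dominated_apply(1)[OF p b c]]
  by (auto simp: matrix_operator_def fun_eq_iff distrib_right infsum_add)

lemma matrix_operator_scale:
  assumes c: "c \<in> lp_space p \<Lambda>"
  shows "matrix_operator p \<Lambda> (\<lambda>x y. z * a x y) c = (\<lambda>x. z * matrix_operator p \<Lambda> a c x)"
  using c by (auto simp: matrix_operator_def fun_eq_iff mult.assoc infsum_cmult_right')

definition identity_matrix :: "'a \<Rightarrow> 'a \<Rightarrow> complex" where
  "identity_matrix x y = (if x \<in> \<Lambda> \<and> x = y then 1 else 0)"

lemma dominated_identity: "dominated identity_matrix (\<lambda>m. if m = 0 then 1 else 0)"
proof -
  have "(\<lambda>m::'g. if m = 0 then 1 else 0 :: real) summable_on UNIV"
    by (rule finite_nonzero_values_imp_summable_on) auto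
  then show ?thesis by (auto simp: dominated_def identity_matrix_def)
qed

lemma matrix_operator_identity: "matrix_operator p \<Lambda> identity_matrix = (\<lambda>c\<in>lp_space p \<Lambda>. c)"
proof -
  have "(\<Sum>\<^sub>\<infinity>y\<in>\<Lambda>. identity_matrix x y * c y) = c x" if "x \<in> \<Lambda>" for x c
  proof -
    have "(\<Sum>\<^sub>\<infinity>y\<in>\<Lambda>. identity_matrix x y * c y) = (\<Sum>\<^sub>\<infinity>y\<in>{x}. c y)"
      using that by (intro infsum_cong_neutral) (auto simp: identity_matrix_def)
    then show ?thesis by simp
  qed
  then show ?thesis by (auto simp: matrix_operator_def lp_space_def fun_eq_iff)
qed

end

section \<open>Inverses of dominated matrices\<close>

text \<open>The translates of \<open>u\<close> that a commutator entry with
  \<open>g x - g z = m\<close> can involve: the shift \<open>i\<close> when \<open>z\<close> lies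
  near \<open>k\<close>, and \<open>i - m\<close> when \<open>x\<close> does.\<close>

definition shift_sum :: "'g::ab_group_add set \<Rightarrow> 'g \<Rightarrow> ('g \<Rightarrow> real) \<Rightarrow> 'g \<Rightarrow> real" where
  "shift_sum I m u k = (\<Sum>i\<in>I. u (k + i) + u (k + i - m))"

lemma shift_sum_nonneg: "(\<And>k. 0 \<le> u k) \<Longrightarrow> 0 \<le> shift_sum I m u k"
  by (auto simp: shift_sum_def intro!: sum_nonneg add_nonneg_nonneg)

lemma shift_sum_le:
  assumes "\<And>k. u k \<le> u' k + c"
  shows "shift_sum I m u k \<le> shift_sum I m u' k + 2 * real (card I) * c"
proof -
  have "shift_sum I m u k \<le> (\<Sum>i\<in>I. (u' (k + i) + u' (k + i - m)) + 2 * c)"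
    unfolding shift_sum_def
  proof (rule sum_mono)
    show "u (k + i) + u (k + i - m) \<le> u' (k + i) + u' (k + i - m) + 2 * c" for i
      using assms[of "k + i"] assms[of "k + i - m"] by linarith
  qed
  then show ?thesis by (simp add: shift_sum_def sum.distrib)
qed

lemma shift_sum_has_sum:
  assumes "(u has_sum s) UNIV" "finite I"
  shows "(shift_sum I m u has_sum 2 * real (card I) * s) UNIV"
  using assms(2)
proof (induction I rule: finite_induct)
  case empty
  then show ?case by (simp add: shift_sum_def[abs_def])
next
  case (insert i I)
  have shift: "((\<lambda>k. u (j + k)) has_sum s) UNIV" for j
    using has_sum_reindex_bij_betw[OF bij_plus_left[of j], of u] assms(1) by simp
  have "((\<lambda>k. (u (i + k) + u ((i - m) + k)) + shift_sum I m u k)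
      has_sum (s + s) + 2 * real (card I) * s) UNIV"
    by (intro has_sum_add shift insert.IH)
  moreover have "(\<lambda>k. (u (i + k) + u ((i - m) + k)) + shift_sum I m u k) = shift_sum (insert i I) m u"
    using insert.hyps by (simp add: shift_sum_def fun_eq_iff algebra_simps)
  ultimately show ?case
    using insert.hyps by (simp add: algebra_simps)
qed

text \<open>
  A Neumann series without inverses: \<open>U t\<close> is the \<open>t\<close>-th partial sum, its total mass is at most
  twice that of \<open>W\<close>, and each \<open>V y\<close> exceeds it by at most \<open>C / 2 ^ t\<close>.
\<close>

lemma summable_majorant:
  fixes V :: "'y \<Rightarrow> 'g::ab_group_add \<Rightarrow> real"
  assumes I: "finite I" and \<epsilon>: "\<epsilon> summable_on UNIV" "\<And>m. 0 \<le> \<epsilon> m"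
    and small: "2 * real (card I) * (\<Sum>\<^sub>\<infinity>m. \<epsilon> m) \<le> 1 / 2"
    and W: "W summable_on UNIV" "\<And>k. 0 \<le> W k" and C: "0 \<le> C"
    and V: "\<And>y k. y \<in> Y \<Longrightarrow> 0 \<le> V y k" "\<And>y k. y \<in> Y \<Longrightarrow> V y k \<le> C"
      "\<And>y k. y \<in> Y \<Longrightarrow> V y k \<le> W k + (\<Sum>\<^sub>\<infinity>m. \<epsilon> m * shift_sum I m (V y) k)"
  shows "\<exists>h. h summable_on UNIV \<and> (\<forall>k. 0 \<le> h k) \<and> (\<forall>y\<in>Y. \<forall>k. V y k \<le> h k)"
proof -
  define E where "E u k = (\<Sum>\<^sub>\<infinity>m. \<epsilon> m * shift_sum I m u k)" for u k
  define U where "U = rec_nat (\<lambda>k. 0) (\<lambda>_ u k. W k + E u k)"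
  have U_0: "U 0 = (\<lambda>k. 0)" and U_Suc: "U (Suc t) = (\<lambda>k. W k + E (U t) k)" for t
    by (simp_all add: U_def)
  define w where "w = (\<Sum>\<^sub>\<infinity>k. W k)"
  have U: "(\<forall>k. 0 \<le> U t k) \<and> (\<exists>s\<le>2 * w. (U t has_sum s) UNIV)" for t
  proof (induction t)
    case 0
    have "0 \<le> w" unfolding w_def using W(2) by (intro infsum_nonneg)
    then show ?case by (auto simp: U_0 intro!: exI[of _ 0])
  next
    case (Suc t)
    then have nn: "\<And>k. 0 \<le> U t k" by simp
    obtain s where s: "s \<le> 2 * w" "(U t has_sum s) UNIV"
      using Suc.IH by blast
    have nnS: "0 \<le> shift_sum I m (U t) k" for m k by (rule shift_sum_nonneg) (rule nn)
    note K = kernel_has_sum[where w = "\<lambda>m. shift_sum I m (U t)", OF \<epsilon> nnS shift_sum_has_sum[OF s(2) I]]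
    have "0 \<le> s" by (rule has_sum_nonneg[OF s(2)]) (rule nn)
    \<comment> \<open>The bound \<open>2 * w\<close> reproduces itself: one \<open>w\<close> comes
      from \<open>W\<close>, and half of \<open>2 * w\<close> from the contraction.\<close>
    have "(2 * real (card I) * (\<Sum>\<^sub>\<infinity>m. \<epsilon> m)) * s \<le> 1 / 2 * s"
      using small \<open>0 \<le> s\<close> by (rule mult_right_mono)
    then have "w + (\<Sum>\<^sub>\<infinity>m. \<epsilon> m) * (2 * real (card I) * s) \<le> 2 * w"
      using s(1) by (simp add: mult_ac)
    moreover have "(U (Suc t) has_sum w + (\<Sum>\<^sub>\<infinity>m. \<epsilon> m) * (2 * real (card I) * s)) UNIV"
      unfolding U_Suc w_def E_def by (intro has_sum_add has_sum_infsum W K)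
    moreover have "0 \<le> U (Suc t) k" for k
      using W(2) \<epsilon>(2) nnS
      by (auto simp: U_Suc E_def intro!: add_nonneg_nonneg infsum_nonneg)
    ultimately show ?case by blast
  qed
  have nnV: "0 \<le> shift_sum I m (V y) k" if "y \<in> Y" for m y k
    using V(1)[OF that] by (rule shift_sum_nonneg)
  have VU: "V y k \<le> U t k + C / 2 ^ t" if y: "y \<in> Y" for y t k
  proof (induction t arbitrary: k)
    case 0
    then show ?case using V(2)[OF y] by (simp add: U_0)
  next
    case (Suc t)
    let ?c = "2 * real (card I) * (C / 2 ^ t)"
    have nn: "\<And>k. 0 \<le> U t k" using U by simp
    obtain s where s: "(U t has_sum s) UNIV"
      using U by blast
    have nnS: "0 \<le> shift_sum I m (U t) k" for m k by (rule shift_sum_nonneg) (rule nn)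
    note K = kernel_has_sum(1)[where w = "\<lambda>m. shift_sum I m (U t)", OF \<epsilon> nnS shift_sum_has_sum[OF s I]]
    have sm: "(\<lambda>m. \<epsilon> m * shift_sum I m (U t) k + \<epsilon> m * ?c) summable_on UNIV"
      by (intro summable_on_add K summable_on_cmult_left \<epsilon>)
    have "shift_sum I m (V y) k \<le> shift_sum I m (U t) k + ?c" for m
      by (rule shift_sum_le) (rule Suc.IH)
    then have le: "\<epsilon> m * shift_sum I m (V y) k \<le> \<epsilon> m * shift_sum I m (U t) k + \<epsilon> m * ?c" for m
      unfolding distrib_left[symmetric] by (rule mult_left_mono[OF _ \<epsilon>(2)])
    have "(\<Sum>\<^sub>\<infinity>m. \<epsilon> m * shift_sum I m (V y) k) \<le>
        (\<Sum>\<^sub>\<infinity>m. \<epsilon> m * shift_sum I m (U t) k + \<epsilon> m * ?c)"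
    proof (rule infsum_mono)
      show "(\<lambda>m. \<epsilon> m * shift_sum I m (V y) k) summable_on UNIV"
        using le \<epsilon>(2) nnV[OF y] by (intro summable_on_comparison_test[OF sm]) auto
    qed (use sm le in auto)
    also have "\<dots> = E (U t) k + (\<Sum>\<^sub>\<infinity>m. \<epsilon> m * ?c)"
      unfolding E_def by (rule infsum_add[OF K summable_on_cmult_left[OF \<epsilon>(1)]])
    also have "(\<Sum>\<^sub>\<infinity>m. \<epsilon> m * ?c) = (\<Sum>\<^sub>\<infinity>m. \<epsilon> m) * ?c"
      by (rule infsum_cmult_left')
    \<comment> \<open>On constants the kernel acts with mass at most one half, so the error halves
      at every step.\<close>
    also have "(\<Sum>\<^sub>\<infinity>m. \<epsilon> m) * ?c \<le> 1 / 2 * (C / 2 ^ t)"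
      using mult_right_mono[OF small, of "C / 2 ^ t"] C by (simp add: mult_ac)
    finally show ?case using V(3)[OF y, of k] by (simp add: U_Suc)
  qed
  \<comment> \<open>The smallest common majorant of all \<open>V y\<close>. Inserting 0 keeps the
    set nonempty when \<open>Y\<close> is empty and makes \<open>h\<close> nonnegative.\<close>
  define h where "h k = Sup (insert 0 ((\<lambda>y. V y k) ` Y))" for k
  have bdd: "bdd_above (insert 0 ((\<lambda>y. V y k) ` Y))" for k
    using V(2) C by (intro bdd_aboveI[of _ C]) auto
  have h0: "0 \<le> h k" and hV: "y \<in> Y \<Longrightarrow> V y k \<le> h k" for y k
    unfolding h_def by (rule cSup_upper[OF _ bdd]; simp)+
  have hU: "h k \<le> U t k + C / 2 ^ t" for k t
    unfolding h_def using VU C U[of t] by (intro cSup_least) (auto intro: add_nonneg_nonneg)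
  \<comment> \<open>For a fixed finite set \<open>F\<close> the accumulated error
    \<open>card F * C / 2 ^ t\<close> vanishes as \<open>t\<close> grows, and the masses of
    \<open>U t\<close> are bounded uniformly in \<open>t\<close>.\<close>
  have "sum h F \<le> 2 * w" if F: "finite F" for F
  proof (rule tendsto_lowerbound)
    show "(\<lambda>t. 2 * w + real (card F) * (C * (1 / 2) ^ t)) \<longlonglongrightarrow> 2 * w"
      by (rule tendsto_eq_intros LIMSEQ_power_zero | simp)+
    show "\<forall>\<^sub>F t in sequentially. sum h F \<le> 2 * w + real (card F) * (C * (1 / 2) ^ t)"
    proof (rule always_eventually, rule allI)
      fix t
      have nn: "\<And>k. 0 \<le> U t k" using U by simp
      obtain s where s: "s \<le> 2 * w" "(U t has_sum s) UNIV"
        using U by blast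
      have "sum h F \<le> (\<Sum>k\<in>F. U t k + C / 2 ^ t)" by (rule sum_mono) (rule hU)
      also have "\<dots> = sum (U t) F + real (card F) * (C * (1 / 2) ^ t)"
        by (simp add: sum.distrib power_one_over)
      also have "sum (U t) F \<le> s" using F s(2) nn by (intro finite_sum_le_has_sum) auto
      finally show "sum h F \<le> 2 * w + real (card F) * (C * (1 / 2) ^ t)" using s(1) by simp
    qed
  qed simp
  then have "h summable_on UNIV"
    using h0 by (intro nonneg_bdd_above_summable_on bdd_aboveI2) auto
  then show ?thesis using h0 hV by blast
qed

section \<open>Commutators with cutoffs, and decay of the columns of an inverse\<close>

context fibered_set
begin

text \<open>A commutator entry is nonzero only if the bump around \<open>k\<close> is nonzero at
  \<open>x\<close> or at \<open>z\<close>. By \<open>cover\<close>, some translated bump is then at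
  least \<open>1 / 2\<close> at \<open>z\<close>, so \<open>norm (c z)\<close> is at most twice the
  corresponding cutoff of \<open>c\<close>. The entry is itself at most \<open>h * \<theta>\<close>,
  and Schur's test sums the diagonals. The factor 2 in the conclusion is the inverse of that
  \<open>1 / 2\<close>.\<close>

lemma commutator_bound:
  assumes p: "1 \<le> p" and a: "dominated a h" and c: "c \<in> lp_space p \<Lambda>"
    and \<tau>: "\<And>m. 0 \<le> \<tau> m" "\<And>m. \<tau> m \<le> 1" and I: "finite I"
    and cover: "\<And>m. \<tau> m \<noteq> 0 \<Longrightarrow> \<exists>i\<in>I. 1 / 2 \<le> \<tau> (m - i)"
    and \<theta>: "\<And>m. 0 \<le> \<theta> m" "\<And>m. \<theta> m \<le> 1" "\<And>m m'. \<bar>\<tau> m - \<tau> m'\<bar> \<le> \<theta> (m - m')"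
  defines "v \<equiv> \<lambda>k. lp_norm p (\<lambda>x. complex_of_real (\<tau> (g x - k)) * c x)"
  shows "(\<lambda>m. h m * \<theta> m * shift_sum I m v k) summable_on UNIV"
    and "lp_bound p (2 * (real N)\<^sup>2 * (\<Sum>\<^sub>\<infinity>m. h m * \<theta> m * shift_sum I m v k))
      (\<lambda>x. if x \<in> \<Lambda> then \<Sum>\<^sub>\<infinity>z\<in>\<Lambda>. norm (a x z) * \<bar>\<tau> (g z - k) - \<tau> (g x - k)\<bar> * norm (c z) else 0)"
proof -
  note h = dominatedD[OF a]
  define u where "u k x = complex_of_real (\<tau> (g x - k)) * c x" for k x
  have norm_\<tau>: "norm (complex_of_real (\<tau> m)) \<le> 1" for m using \<tau> by simp
  note cut = lp_space_mult_le_1[OF p c norm_\<tau>]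
  have u: "u k \<in> lp_space p \<Lambda>" and v: "v k = lp_norm p (u k)" for k
    using cut(1) by (auto simp: u_def[abs_def] v_def)
  have v_nonneg: "0 \<le> v k" for k unfolding v by (rule lp_norm_nonneg[OF p u])
  have v_le: "v k \<le> lp_norm p c" for k unfolding v_def by (rule cut(2))
  define F where "F m z = 2 * (\<Sum>i\<in>I. norm (u (k + i) z) + norm (u (k + i - m) z))" for m z
  have F: "lp_bound p (2 * shift_sum I m v k) (F m)" for m
    unfolding F_def shift_sum_def v
    by (intro lp_bound_cmult lp_bound_sum[OF p I] lp_bound_add[OF p] lp_bound_lp_norm[OF p u]) simp
  have sm_h: "(\<lambda>m. h m * \<theta> m) summable_on UNIV"
    using summable_on_sup_bounded_mult[OF h(2) h(1) \<theta>(1,2)] by simp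
  have nonneg: "0 \<le> shift_sum I m v k" for m by (rule shift_sum_nonneg) (rule v_nonneg)
  have shift_le: "shift_sum I m v k \<le> 2 * real (card I) * lp_norm p c" for m
    using shift_sum_le[of v "\<lambda>_. 0" "lp_norm p c" I m k] v_le by (simp add: shift_sum_def)
  show sm: "(\<lambda>m. h m * \<theta> m * shift_sum I m v k) summable_on UNIV"
    by (rule summable_on_sup_bounded_mult[OF sm_h _ nonneg shift_le]) (use h \<theta> in auto)
  then have sm2: "(\<lambda>m. h m * \<theta> m * (2 * shift_sum I m v k)) summable_on UNIV"
    unfolding mult.left_commute[of _ "2 :: real"] by (rule summable_on_cmult_right)
  let ?X = "\<lambda>x z. norm (a x z) * \<bar>\<tau> (g z - k) - \<tau> (g x - k)\<bar> * norm (c z)"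
  have X_le: "?X x z \<le> h (g x - g z) * \<theta> (g x - g z) * F (g x - g z) z"
    if xz: "x \<in> \<Lambda>" "z \<in> \<Lambda>" for x z
  proof (cases "\<tau> (g z - k) = 0 \<and> \<tau> (g x - k) = 0")
    case True
    then show ?thesis
      using h(1) \<theta>(1) lp_bound_nonneg[OF F] by auto
  next
    case False
    have near: "norm (c z) \<le> 2 * norm (u j z)" if "1 / 2 \<le> \<tau> (g z - j)" for j
      using mult_right_mono[OF that, of "norm (c z)"] \<tau>(1)[of "g z - j"]
      by (simp add: u_def norm_mult)
    have "norm (c z) \<le> F (g x - g z) z"
    proof -
      have *: "norm (u (k + i) z) + norm (u (k + i - (g x - g z)) z) \<le>
          (\<Sum>i\<in>I. norm (u (k + i) z) + norm (u (k + i - (g x - g z)) z))" if "i \<in> I" for i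
        using that I by (intro member_le_sum) auto
      from False consider "\<tau> (g z - k) \<noteq> 0" | "\<tau> (g x - k) \<noteq> 0" by blast
      then show ?thesis
      proof cases
        case 1
        then obtain i where i: "i \<in> I" "1 / 2 \<le> \<tau> (g z - (k + i))"
          using cover by (metis diff_diff_eq)
        have "norm (c z) \<le> 2 * norm (u (k + i) z)" by (rule near[OF i(2)])
        then show ?thesis using *[OF i(1)] norm_ge_zero unfolding F_def by (smt (verit))
      next
        case 2
        then obtain i where i: "i \<in> I" "1 / 2 \<le> \<tau> (g x - (k + i))"
          using cover by (metis diff_diff_eq)
        \<comment> \<open>Moving the centre by \<open>g x - g z\<close> gives the bump the same
          value at \<open>z\<close> as the original one has at \<open>x\<close>.\<close>
        have "norm (c z) \<le> 2 * norm (u (k + i - (g x - g z)) z)"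
          using i(2) by (intro near) (simp add: algebra_simps)
        then show ?thesis using *[OF i(1)] norm_ge_zero unfolding F_def by (smt (verit))
      qed
    qed
    moreover have "\<bar>\<tau> (g z - k) - \<tau> (g x - k)\<bar> \<le> \<theta> (g x - g z)"
      using \<theta>(3)[of "g x - k" "g z - k"] by (simp add: abs_minus_commute)
    ultimately show ?thesis
      using h(1) h(3)[OF xz] \<theta>(1) by (intro mult_mono) auto
  qed
  have "lp_bound p ((real N)\<^sup>2 * (\<Sum>\<^sub>\<infinity>m. h m * \<theta> m * (2 * shift_sum I m v k)))
      (\<lambda>x. if x \<in> \<Lambda> then \<Sum>\<^sub>\<infinity>z\<in>\<Lambda>. ?X x z else 0)"
    by (rule schur_test(2)[OF p _ sm2 F _ X_le]) (use h \<theta> in auto)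
  moreover have "(\<Sum>\<^sub>\<infinity>m. h m * \<theta> m * (2 * shift_sum I m v k)) =
      2 * (\<Sum>\<^sub>\<infinity>m. h m * \<theta> m * shift_sum I m v k)"
    unfolding mult.left_commute[of _ "2 :: real"] by (rule infsum_cmult_right')
  ultimately show "lp_bound p (2 * (real N)\<^sup>2 * (\<Sum>\<^sub>\<infinity>m. h m * \<theta> m * shift_sum I m v k))
      (\<lambda>x. if x \<in> \<Lambda> then \<Sum>\<^sub>\<infinity>z\<in>\<Lambda>. ?X x z else 0)"
    by (simp add: mult_ac)
qed

text \<open>Column \<open>y\<close> is cut off around \<open>k + g y\<close>, so that all columns
  obey one recursion with the same \<open>W\<close> and \<open>\<epsilon>\<close>, and
  \<open>summable_majorant\<close> yields a common bound. The constant 8 collects three factors 2: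
  from \<open>commutator_bound\<close>, from the two families of translates in
  \<open>shift_sum\<close>, and from the contraction factor one half.\<close>

lemma inverse_dominated_cutoff:
  assumes p: "1 \<le> p" and a: "dominated a h" and K: "0 \<le> K"
    and inv: "\<And>c. c \<in> lp_space p \<Lambda> \<Longrightarrow> lp_norm p c \<le> K * lp_norm p (matrix_operator p \<Lambda> a c)"
    and b: "\<And>y. y \<in> \<Lambda> \<Longrightarrow> (\<lambda>x. b x y) \<in> lp_space p \<Lambda>"
      "\<And>y. y \<in> \<Lambda> \<Longrightarrow> matrix_operator p \<Lambda> a (\<lambda>x. b x y) = unit_vector y"
    and \<tau>: "\<And>m. 0 \<le> \<tau> m" "\<And>m. \<tau> m \<le> 1" "\<tau> 0 = 1" "finite {m. \<tau> m \<noteq> 0}" and I: "finite I"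
    and cover: "\<And>m. \<tau> m \<noteq> 0 \<Longrightarrow> \<exists>i\<in>I. 1 / 2 \<le> \<tau> (m - i)"
    and \<theta>: "\<And>m. 0 \<le> \<theta> m" "\<And>m. \<theta> m \<le> 1" "\<And>m m'. \<bar>\<tau> m - \<tau> m'\<bar> \<le> \<theta> (m - m')"
    and small: "8 * K * (real N)\<^sup>2 * real (card I) * (\<Sum>\<^sub>\<infinity>m. h m * \<theta> m) \<le> 1"
  shows "\<exists>h'. dominated b h'"
proof -
  note h = dominatedD[OF a]
  define V where "V y k = lp_norm p (\<lambda>x. complex_of_real (\<tau> (g x - (k + g y))) * b x y)" for y k
  define \<epsilon> where "\<epsilon> m = 2 * K * (real N)\<^sup>2 * (h m * \<theta> m)" for m
  \<comment> \<open>The contribution of the unit vector: the bump around \<open>k + g y\<close>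
    takes the value \<open>\<tau> (- k)\<close> at \<open>y\<close>, whichever column is considered.
    Its support is finite.\<close>
  define W where "W k = K * \<tau> (- k)" for k
  have norm_\<tau>: "norm (complex_of_real (\<tau> m)) \<le> 1" for m using \<tau> by simp
  have sm_h: "(\<lambda>m. h m * \<theta> m) summable_on UNIV"
    using summable_on_sup_bounded_mult[OF h(2) h(1) \<theta>(1,2)] by simp
  have V_nonneg: "0 \<le> V y k" and V_le: "V y k \<le> K" if y: "y \<in> \<Lambda>" for y k
  proof -
    note cut = lp_space_mult_le_1[OF p b(1)[OF y] norm_\<tau>]
    show "0 \<le> V y k" unfolding V_def by (rule lp_norm_nonneg[OF p cut(1)])
    have "V y k \<le> lp_norm p (\<lambda>x. b x y)" unfolding V_def by (rule cut(2))
    also have "\<dots> \<le> K * lp_norm p (unit_vector y)" using inv[OF b(1)[OF y]] b(2)[OF y] by simp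
    also have "\<dots> \<le> K * 1" by (intro mult_left_mono unit_vector_lp[OF p y] K)
    finally show "V y k \<le> K" by simp
  qed
  have V_rec: "V y k \<le> W k + (\<Sum>\<^sub>\<infinity>m. \<epsilon> m * shift_sum I m (V y) k)" if y: "y \<in> \<Lambda>" for y k
  proof -
    define c where "c = (\<lambda>x. b x y)"
    define k' where "k' = k + g y"
    define u where "u x = complex_of_real (\<tau> (g x - k')) * c x" for x
    define v where "v j = lp_norm p (\<lambda>x. complex_of_real (\<tau> (g x - j)) * c x)" for j
    define R where "R x = (if x \<in> \<Lambda> then \<Sum>\<^sub>\<infinity>z\<in>\<Lambda>. norm (a x z) * \<bar>\<tau> (g z - k') - \<tau> (g x - k')\<bar> * norm (c z) else 0)" for x
    let ?S = "\<Sum>\<^sub>\<infinity>m. h m * \<theta> m * shift_sum I m v k'"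
    have c: "c \<in> lp_space p \<Lambda>" unfolding c_def by (rule b(1)[OF y])
    have u: "u \<in> lp_space p \<Lambda>" unfolding u_def[abs_def] by (rule lp_space_mult_le_1[OF p c norm_\<tau>])
    have vV: "v (j + g y) = V y j" for j by (simp add: v_def V_def c_def)
    have shift: "shift_sum I m v k' = shift_sum I m (V y) k" for m
      unfolding shift_sum_def vV[symmetric] by (simp add: k'_def algebra_simps)
    have R: "lp_bound p (2 * (real N)\<^sup>2 * ?S) R"
      using commutator_bound(2)[OF p a c \<tau>(1,2) I cover \<theta>, of k'] unfolding R_def[abs_def] v_def by blast
    have unit: "lp_bound p (\<tau> (g y - k') * 1) (\<lambda>x. \<tau> (g y - k') * (if x = y then 1 else 0))"
      by (rule lp_bound_cmult[OF lp_bound_indicator \<tau>(1)])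
    have "norm (matrix_operator p \<Lambda> a u x) \<le> \<tau> (g y - k') * (if x = y then 1 else 0) + R x" for x
    proof (cases "x \<in> \<Lambda>")
      case True
      have sc: "(\<lambda>z. a x z * c z) summable_on \<Lambda>"
        by (rule abs_summable_summable[OF dominated_apply(1)[OF p a c True]])
      have su: "(\<lambda>z. a x z * u z) summable_on \<Lambda>"
        by (rule abs_summable_summable[OF dominated_apply(1)[OF p a u True]])
      let ?d = "\<lambda>z. complex_of_real (\<tau> (g z - k') - \<tau> (g x - k'))"
      \<comment> \<open>The row of \<open>A\<close> applied to the cutoff splits into the bump value
        at \<open>x\<close> times the row applied to \<open>c\<close>, which is an entry of the unit
        vector, and a commutator term.\<close>
      have d: "a x z * (?d z * c z) = a x z * u z - complex_of_real (\<tau> (g x - k')) * (a x z * c z)" for z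
        by (simp add: u_def algebra_simps)
      have "norm (?d z) \<le> 1" for z
        using order_trans[OF \<theta>(3) \<theta>(2)] unfolding norm_of_real .
      then have dc: "(\<lambda>z. ?d z * c z) \<in> lp_space p \<Lambda>" by (rule lp_space_mult_le_1[OF p c])
      note abs_d = dominated_apply(1)[OF p a dc True]
      have "matrix_operator p \<Lambda> a u x = (\<Sum>\<^sub>\<infinity>z\<in>\<Lambda>. a x z * u z)"
        using u True by (simp add: matrix_operator_def)
      also have "\<dots> = (\<Sum>\<^sub>\<infinity>z\<in>\<Lambda>. complex_of_real (\<tau> (g x - k')) * (a x z * c z) + a x z * (?d z * c z))"
        unfolding d by simp
      also have "\<dots> = complex_of_real (\<tau> (g x - k')) * (\<Sum>\<^sub>\<infinity>z\<in>\<Lambda>. a x z * c z) + (\<Sum>\<^sub>\<infinity>z\<in>\<Lambda>. a x z * (?d z * c z))"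
        unfolding infsum_cmult_right'[symmetric]
        by (rule infsum_add[OF summable_on_cmult_right[OF sc] abs_summable_summable[OF abs_d]])
      also have "(\<Sum>\<^sub>\<infinity>z\<in>\<Lambda>. a x z * c z) = unit_vector y x"
        using fun_cong[OF b(2)[OF y], of x] b(1)[OF y] True by (simp add: matrix_operator_def c_def)
      finally have eq: "matrix_operator p \<Lambda> a u x =
        complex_of_real (\<tau> (g x - k')) * unit_vector y x + (\<Sum>\<^sub>\<infinity>z\<in>\<Lambda>. a x z * (?d z * c z))" .
      have "norm (\<Sum>\<^sub>\<infinity>z\<in>\<Lambda>. a x z * (?d z * c z)) \<le> (\<Sum>\<^sub>\<infinity>z\<in>\<Lambda>. norm (a x z * (?d z * c z)))"
        by (rule norm_infsum_bound[OF abs_d])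
      also have "\<dots> = R x"
        using True by (simp add: R_def norm_mult mult.assoc del: of_real_diff)
      finally have "norm (matrix_operator p \<Lambda> a u x) \<le>
          norm (complex_of_real (\<tau> (g x - k')) * unit_vector y x) + R x"
        unfolding eq by (intro order_trans[OF norm_triangle_ineq] add_left_mono)
      also have "norm (complex_of_real (\<tau> (g x - k')) * unit_vector y x) = \<tau> (g y - k') * (if x = y then 1 else 0)"
        using \<tau>(1) by (simp add: norm_mult unit_vector_def)
      finally show ?thesis .
    next
      case False
      then show ?thesis using u y by (auto simp: matrix_operator_def R_def)
    qed
    then have "lp_norm p (matrix_operator p \<Lambda> a u) \<le> \<tau> (g y - k') * 1 + 2 * (real N)\<^sup>2 * ?S"
      using lp_space_dominated(2)[OF p lp_bound_add[OF p unit R], of "matrix_operator p \<Lambda> a u" \<Lambda>]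
        dominated_apply(3)[OF p a u] by (simp add: lp_space_def)
    then have "V y k \<le> K * (\<tau> (g y - k') * 1 + 2 * (real N)\<^sup>2 * ?S)"
      using inv[OF u] K unfolding V_def u_def[abs_def] c_def k'_def
      by (meson mult_left_mono order_trans)
    also have "\<dots> = W k + 2 * K * (real N)\<^sup>2 * ?S"
      by (simp add: W_def k'_def algebra_simps)
    also have "2 * K * (real N)\<^sup>2 * ?S = (\<Sum>\<^sub>\<infinity>m. \<epsilon> m * shift_sum I m (V y) k)"
      unfolding \<epsilon>_def shift mult.assoc[of "2 * K * (real N)\<^sup>2"] by (rule infsum_cmult_right'[symmetric])
    finally show ?thesis .
  qed
  have "\<exists>h'. h' summable_on UNIV \<and> (\<forall>k. 0 \<le> h' k) \<and> (\<forall>y\<in>\<Lambda>. \<forall>k. V y k \<le> h' k)"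
  proof (rule summable_majorant[OF I])
    show "\<epsilon> summable_on UNIV" unfolding \<epsilon>_def[abs_def] by (rule summable_on_cmult_right[OF sm_h])
    show "0 \<le> \<epsilon> m" for m using K h(1) \<theta>(1) by (simp add: \<epsilon>_def)
    have "(\<Sum>\<^sub>\<infinity>m. \<epsilon> m) = 2 * K * (real N)\<^sup>2 * (\<Sum>\<^sub>\<infinity>m. h m * \<theta> m)"
      unfolding \<epsilon>_def by (rule infsum_cmult_right')
    then show "2 * real (card I) * (\<Sum>\<^sub>\<infinity>m. \<epsilon> m) \<le> 1 / 2"
      using small by (simp add: mult_ac)
    show "W summable_on UNIV"
    proof (rule finite_nonzero_values_imp_summable_on)
      have "{k \<in> UNIV. W k \<noteq> 0} \<subseteq> uminus ` {m. \<tau> m \<noteq> 0}"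
        by (force simp: W_def image_iff)
      then show "finite {k \<in> UNIV. W k \<noteq> 0}" using \<tau>(4) finite_surj by blast
    qed
    show "0 \<le> W k" for k using K \<tau>(1) by (simp add: W_def)
  qed (use K V_nonneg V_le V_rec in auto)
  then obtain h' where h': "h' summable_on UNIV" "\<And>k. 0 \<le> h' k" "\<And>y k. y \<in> \<Lambda> \<Longrightarrow> V y k \<le> h' k"
    by blast
  have "norm (b x y) \<le> h' (g x - g y)" if "x \<in> \<Lambda>" "y \<in> \<Lambda>" for x y
  proof -
    \<comment> \<open>The bump centred at \<open>g x\<close> equals 1 at \<open>x\<close>, so the
      entry is at most the norm of the cutoff. The centre is left unsimplified to match
      \<open>V y (g x - g y)\<close>.\<close>
    let ?w = "\<lambda>z. complex_of_real (\<tau> (g z - (g x - g y + g y)))"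
    have "(\<lambda>z. ?w z * b z y) \<in> lp_space p \<Lambda>"
      by (rule lp_space_mult_le_1[OF p b(1)[OF that(2)] norm_\<tau>])
    from lp_space_pointwise[OF p this, of x] have "norm (b x y) \<le> V y (g x - g y)"
      using \<tau>(3) by (simp add: V_def)
    then show ?thesis using h'(3)[OF that(2)] by (rule order_trans)
  qed
  then show ?thesis using h' by (auto simp: dominated_def)
qed

end

text \<open>Dominated convergence for series: a finite set carries all but \<open>e / 2\<close> of
  the mass of \<open>h\<close>, the weights tend to 0 on it, and they are at most 1 outside.\<close>

lemma weighted_sum_tendsto_0:
  fixes h :: "'g \<Rightarrow> real"
  assumes h: "h summable_on UNIV" "\<And>m. 0 \<le> h m"
    and \<theta>: "\<And>n m. 0 \<le> \<theta> n m" "\<And>n m. \<theta> n m \<le> 1" "\<And>m. (\<lambda>n. \<theta> n m) \<longlonglongrightarrow> 0"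
  shows "(\<lambda>n. \<Sum>\<^sub>\<infinity>m. h m * \<theta> n m) \<longlonglongrightarrow> 0"
proof (rule LIMSEQ_I)
  fix e :: real assume "0 < e"
  then obtain F where F: "finite F" "dist (sum h F) (infsum h UNIV) \<le> e / 2"
    using infsum_finite_approximation[OF h(1), of "e / 2"] by auto
  have "(\<lambda>n. \<Sum>m\<in>F. h m * \<theta> n m) \<longlonglongrightarrow> (\<Sum>m\<in>F. h m * 0)"
    by (intro tendsto_sum tendsto_mult tendsto_const \<theta>(3))
  from LIMSEQ_D[OF this, of "e / 2"] \<open>0 < e\<close>
  obtain n0 where n0: "\<And>n. n0 \<le> n \<Longrightarrow> norm (\<Sum>m\<in>F. h m * \<theta> n m) < e / 2"
    by (simp only: mult_zero_right sum.neutral_const diff_zero half_gt_zero_iff) blast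
  have "norm ((\<Sum>\<^sub>\<infinity>m. h m * \<theta> n m) - 0) < e" if n: "n0 \<le> n" for n
  proof -
    have sm: "(\<lambda>m. h m * \<theta> n m) summable_on UNIV"
      by (rule summable_on_sup_bounded_mult[OF h \<theta>(1,2)])
    have split: "infsum f UNIV = sum f F + infsum f (- F)"
      if "f summable_on UNIV" for f :: "'g \<Rightarrow> real"
      using infsum_Un_disjoint[of f F "- F"] that F(1) by (auto intro: summable_on_subset)
    have "(\<Sum>\<^sub>\<infinity>m\<in>- F. h m * \<theta> n m) \<le> infsum h (- F)"
    proof (rule infsum_mono)
      show "h m * \<theta> n m \<le> h m" for m using mult_left_mono[OF \<theta>(2) h(2)] by simp
    qed (rule summable_on_subset[OF sm] summable_on_subset[OF h(1)]; simp)+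
    also have "\<dots> \<le> e / 2" using F(2) split[OF h(1)] by (simp add: dist_real_def)
    finally have "(\<Sum>\<^sub>\<infinity>m. h m * \<theta> n m) < e"
      using n0[OF n] split[OF sm] by simp
    moreover have "0 \<le> (\<Sum>\<^sub>\<infinity>m. h m * \<theta> n m)"
      by (rule infsum_nonneg) (use h \<theta> in auto)
    ultimately show ?thesis by simp
  qed
  then show "\<exists>n0. \<forall>n\<ge>n0. norm ((\<Sum>\<^sub>\<infinity>m. h m * \<theta> n m) - 0) < e" by blast
qed

section \<open>Tent functions on the integer lattice\<close>

lemma finite_vec_set:
  assumes "finite S"
  shows "finite {m :: 'b ^ 'd. \<forall>i. m $ i \<in> S}"
proof -
  have "finite (PiE (UNIV :: 'd set) (\<lambda>_. S))" using assms by (intro finite_PiE) auto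
  then show ?thesis
    by (rule finite_surj[of _ _ vec_lambda]) (auto simp: image_iff intro!: bexI[of _ "vec_nth _"])
qed

definition real_vec :: "int ^ 'd \<Rightarrow> real ^ 'd" where
  "real_vec m = (\<chi> i. real_of_int (m $ i))"

lemma real_vec_nth [simp]: "real_vec m $ i = real_of_int (m $ i)"
  by (simp add: real_vec_def)

lemma real_vec_0: "real_vec 0 = 0"
  by (simp add: vec_eq_iff)

lemma real_vec_diff: "real_vec (m - m') = real_vec m - real_vec m'"
  by (simp add: vec_eq_iff)

lemma infnorm_le_cart: "(\<And>i. \<bar>x $ i\<bar> \<le> B) \<Longrightarrow> infnorm (x :: real ^ 'd) \<le> B"
  unfolding infnorm_cart by (rule cSup_least) auto

text \<open>The cutoffs are tents of height 1 and radius \<open>2 * r\<close> in the maximum norm.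
  They are Lipschitz with constant \<open>1 / (2 * r)\<close> and at least \<open>1 / 2\<close>
  within distance \<open>r\<close>; the maximum norm lets the covering translates be chosen
  coordinate by coordinate.\<close>

lemma inverse_dominated:
  fixes g :: "'a \<Rightarrow> int ^ 'd"
  assumes "fibered_set \<Lambda> g N"
    and p: "1 \<le> p" and a: "fibered_set.dominated \<Lambda> g a h" and K: "0 \<le> K"
    and inv: "\<And>c. c \<in> lp_space p \<Lambda> \<Longrightarrow> lp_norm p c \<le> K * lp_norm p (matrix_operator p \<Lambda> a c)"
    and b: "\<And>y. y \<in> \<Lambda> \<Longrightarrow> (\<lambda>x. b x y) \<in> lp_space p \<Lambda>"
      "\<And>y. y \<in> \<Lambda> \<Longrightarrow> matrix_operator p \<Lambda> a (\<lambda>x. b x y) = unit_vector y"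
  shows "\<exists>h'. fibered_set.dominated \<Lambda> g b h'"
proof -
  interpret fibered_set \<Lambda> g N by (rule assms(1))
  note h = dominatedD[OF a]
  define \<rho> where "\<rho> m = infnorm (real_vec m)" for m :: "int ^ 'd"
  have \<rho>0: "0 \<le> \<rho> m" for m by (simp add: \<rho>_def infnorm_pos_le)
  have \<rho>_comp: "\<bar>real_of_int (m $ i)\<bar> \<le> \<rho> m" for m i
    using component_le_infnorm_cart[of "real_vec m" i] by (simp add: \<rho>_def)
  have \<rho>_lip: "\<bar>\<rho> m - \<rho> m'\<bar> \<le> \<rho> (m - m')" for m m'
    unfolding \<rho>_def real_vec_diff by (rule absdiff_infnorm)
  \<comment> \<open>Bounds the increments of the tent: by its Lipschitz constant, and by 1 because
    its values lie in the unit interval. \<open>Suc n\<close> keeps the radius positive.\<close>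
  define \<theta> where "\<theta> n m = min 1 (\<rho> m / (2 * real (Suc n)))" for n m
  \<comment> \<open>The cover of a bump of width \<open>n\<close> needs at most \<open>card J\<close> translates whatever \<open>n\<close> is, so the
    vanishing of \<open>\<Sum>\<^sub>\<infinity>m. h m * \<theta> n m\<close> suffices for smallness.\<close>
  define J where "J = {j :: int ^ 'd. \<forall>i. j $ i \<in> {- 1, 0, 1}}"
  have J: "finite J" unfolding J_def by (rule finite_vec_set) simp
  have "(\<lambda>n. \<theta> n m) \<longlonglongrightarrow> 0" for m
  proof -
    have "(\<lambda>n. min 1 (\<rho> m / 2 * inverse (real (Suc n)))) \<longlonglongrightarrow> min 1 (\<rho> m / 2 * 0)"
      by (rule tendsto_min[OF tendsto_const tendsto_mult_left[OF LIMSEQ_inverse_real_of_nat]])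
    moreover have "min 1 (\<rho> m / 2 * 0) = 0" by simp
    moreover have "\<theta> n m = min 1 (\<rho> m / 2 * inverse (real (Suc n)))" for n
      unfolding \<theta>_def by (simp only: divide_inverse inverse_mult_distrib mult.assoc)
    ultimately show ?thesis by (simp only:)
  qed
  then have "(\<lambda>n. \<Sum>\<^sub>\<infinity>m. h m * \<theta> n m) \<longlonglongrightarrow> 0"
    using \<rho>0 by (intro weighted_sum_tendsto_0 h) (auto simp: \<theta>_def)
  then have "(\<lambda>n. 8 * K * (real N)\<^sup>2 * real (card J) * (\<Sum>\<^sub>\<infinity>m. h m * \<theta> n m))
      \<longlonglongrightarrow> 8 * K * (real N)\<^sup>2 * real (card J) * 0"
    by (rule tendsto_mult_left)
  then have "\<forall>\<^sub>F n in sequentially. 8 * K * (real N)\<^sup>2 * real (card J) * (\<Sum>\<^sub>\<infinity>m. h m * \<theta> n m) < 1"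
    by (rule order_tendstoD) simp
  then obtain n where n: "8 * K * (real N)\<^sup>2 * real (card J) * (\<Sum>\<^sub>\<infinity>m. h m * \<theta> n m) < 1"
    using eventually_happens'[OF sequentially_bot] by blast
  define r where "r = int (Suc n)"
  have r: "0 < r" "real_of_int r = real (Suc n)" by (simp_all add: r_def)
  define \<tau> where "\<tau> m = max 0 (1 - \<rho> m / (2 * real_of_int r))" for m
  define I where "I = (\<lambda>j. \<chi> i. r * j $ i) ` J"
  have \<theta>_r: "\<theta> n m = min 1 (\<rho> m / (2 * real_of_int r))" for m by (simp add: \<theta>_def r_def)
  have supp: "\<bar>m $ i\<bar> < 2 * r" if "\<tau> m \<noteq> 0" for m i
  proof -
    have "\<rho> m < 2 * real_of_int r"
      using that r(1) by (auto simp: \<tau>_def max_def divide_simps split: if_splits)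
    with \<rho>_comp[of m i] have "real_of_int \<bar>m $ i\<bar> < real_of_int (2 * r)" by simp
    then show ?thesis by (simp only: of_int_less_iff)
  qed
  show ?thesis
  proof (rule inverse_dominated_cutoff[OF p a K inv b, of \<tau> I "\<theta> n"])
    show "0 \<le> \<tau> m" "\<tau> m \<le> 1" for m using \<rho>0[of m] r by (auto simp: \<tau>_def)
    show "\<tau> 0 = 1" by (simp add: \<tau>_def \<rho>_def real_vec_0 infnorm_0)
    show "finite {m. \<tau> m \<noteq> 0}"
    proof (rule finite_subset[OF _ finite_vec_set])
      have "m $ i \<in> {- (2 * r)..2 * r}" if "\<tau> m \<noteq> 0" for m i
        using supp[OF that, of i] by auto
      then show "{m. \<tau> m \<noteq> 0} \<subseteq> {m. \<forall>i. m $ i \<in> {- (2 * r)..2 * r}}" by blast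
    qed simp
    show "finite I" using J by (simp add: I_def)
    show "\<exists>i\<in>I. 1 / 2 \<le> \<tau> (m - i)" if "\<tau> m \<noteq> 0" for m
    proof -
      \<comment> \<open>Coordinates of modulus above \<open>r\<close> are moved by \<open>r\<close>
        towards 0. As all of them are below \<open>2 * r\<close> in modulus, none exceeds
        \<open>r\<close> afterwards.\<close>
      define j :: "int ^ 'd" where
        "j = (\<chi> i. if r < m $ i then 1 else if m $ i < - r then - 1 else 0)"
      define k :: "int ^ 'd" where "k = (\<chi> i. r * j $ i)"
      have "j \<in> J" by (simp add: J_def j_def)
      then have "k \<in> I" unfolding I_def k_def by (rule imageI)
      have "\<bar>(m - k) $ i\<bar> \<le> r" for i
        using supp[OF that, of i] r(1) by (auto simp: k_def j_def)
      then have "\<bar>real_vec (m - k) $ i\<bar> \<le> real_of_int r" for i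
        by (metis of_int_abs of_int_le_iff real_vec_nth)
      then have "\<rho> (m - k) \<le> real_of_int r"
        unfolding \<rho>_def by (rule infnorm_le_cart)
      then have "1 / 2 \<le> \<tau> (m - k)" using r(1) by (simp add: \<tau>_def field_simps le_max_iff_disj)
      with \<open>k \<in> I\<close> show ?thesis by blast
    qed
    show "0 \<le> \<theta> n m" "\<theta> n m \<le> 1" for m using \<rho>0 by (auto simp: \<theta>_def)
    show "\<bar>\<tau> m - \<tau> m'\<bar> \<le> \<theta> n (m - m')" for m m'
    proof -
      have "\<bar>\<tau> m - \<tau> m'\<bar> \<le> \<bar>\<rho> m / (2 * real_of_int r) - \<rho> m' / (2 * real_of_int r)\<bar>"
        by (auto simp: \<tau>_def max_def)
      also have "\<dots> = \<bar>\<rho> m - \<rho> m'\<bar> / (2 * real_of_int r)"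
        using r(1) by (simp add: diff_divide_distrib[symmetric] abs_divide)
      also have "\<dots> \<le> \<rho> (m - m') / (2 * real_of_int r)"
        using r(1) by (intro divide_right_mono \<rho>_lip) simp
      finally have "\<bar>\<tau> m - \<tau> m'\<bar> \<le> \<rho> (m - m') / (2 * real_of_int r)" .
      moreover have "0 \<le> \<tau> m" "\<tau> m \<le> 1" "0 \<le> \<tau> m'" "\<tau> m' \<le> 1"
        using \<rho>0 r(1) by (auto simp: \<tau>_def)
      ultimately show ?thesis by (simp add: \<theta>_r)
    qed
    have "0 \<le> (\<Sum>\<^sub>\<infinity>m. h m * \<theta> n m)"
      by (rule infsum_nonneg) (use h(1) \<rho>0 in \<open>auto simp: \<theta>_def\<close>)
    moreover have "card I \<le> card J" unfolding I_def by (rule card_image_le[OF J])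
    ultimately have "8 * K * (real N)\<^sup>2 * real (card I) * (\<Sum>\<^sub>\<infinity>m. h m * \<theta> n m)
        \<le> 8 * K * (real N)\<^sup>2 * real (card J) * (\<Sum>\<^sub>\<infinity>m. h m * \<theta> n m)"
      using K by (intro mult_right_mono mult_left_mono) auto
    then show "8 * K * (real N)\<^sup>2 * real (card I) * (\<Sum>\<^sub>\<infinity>m. h m * \<theta> n m) \<le> 1" using n by simp
  qed
qed

section \<open>Rounding to the lattice\<close>

lemma sum_le_infsum_ennreal:
  fixes f :: "'a \<Rightarrow> ennreal"
  assumes "finite F" "F \<subseteq> A"
  shows "sum f F \<le> infsum f A"
proof -
  have "infsum f F \<le> infsum f A"
    by (rule infsum_mono_neutral) (use assms in \<open>auto intro: nonneg_summable_on_complete\<close>)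
  then show ?thesis using assms(1) by simp
qed

lemma summable_on_sum:
  fixes f :: "'e \<Rightarrow> 'k \<Rightarrow> real"
  assumes "finite E" "\<And>e. e \<in> E \<Longrightarrow> f e summable_on A"
  shows "(\<lambda>k. \<Sum>e\<in>E. f e k) summable_on A"
  using assms by (induction E rule: finite_induct) (auto intro: summable_on_add)

definition floor_vec :: "real ^ 'd \<Rightarrow> int ^ 'd" where
  "floor_vec x = (\<chi> i. \<lfloor>x $ i\<rfloor>)"

lemma floor_vec_nth [simp]: "floor_vec x $ i = \<lfloor>x $ i\<rfloor>"
  by (simp add: floor_vec_def)

lemma mem_translated_cube_iff: "x \<in> (+) y ` unit_cube \<longleftrightarrow> x - y \<in> unit_cube"
  by (auto simp: image_iff intro!: bexI[of _ "x - y"])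

lemma mem_lattice_cube_iff: "x \<in> (+) (real_vec k) ` unit_cube \<longleftrightarrow> floor_vec x = k"
proof -
  have "0 \<le> x $ i - real_of_int (k $ i) \<and> x $ i - real_of_int (k $ i) < 1 \<longleftrightarrow> \<lfloor>x $ i\<rfloor> = k $ i" for i
    by (auto simp: floor_eq_iff)
  then show ?thesis
    unfolding mem_translated_cube_iff by (simp add: unit_cube_def vec_eq_iff)
qed

lemma bij_betw_real_vec: "bij_betw real_vec UNIV (integer_lattice :: (real ^ 'd) set)"
proof (rule bij_betwI[of _ _ _ floor_vec])
  show "real_vec (floor_vec x) = x" if "x \<in> integer_lattice" for x :: "real ^ 'd"
    using that by (auto simp: integer_lattice_def vec_eq_iff elim!: Ints_cases)
qed (auto simp: integer_lattice_def vec_eq_iff)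

text \<open>The possible discrepancies between the difference of two rounded points and the rounded
  difference.\<close>

definition unit_corners :: "(int ^ 'd) set" where
  "unit_corners = {e. \<forall>i. e $ i \<in> {0, 1}}"

lemma finite_unit_corners: "finite unit_corners"
  unfolding unit_corners_def by (rule finite_vec_set) simp

text \<open>In each coordinate the difference of the fractional parts lies strictly between -1 and
  1, so its floor is -1 or 0.\<close>

lemma floor_vec_diff: "floor_vec x - floor_vec y - floor_vec (x - y) \<in> unit_corners"
proof -
  have "\<lfloor>s\<rfloor> - \<lfloor>t\<rfloor> - \<lfloor>s - t\<rfloor> \<in> {0, 1}" for s t :: real
    by (simp, linarith)
  then show ?thesis by (simp add: unit_corners_def)
qed

text \<open>The points that round to the same lattice point have translated cubes with a common
  point, so the finite supremum bounds how many there are.\<close>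

lemma relatively_separated_fibered:
  fixes \<Lambda> :: "(real ^ 'd) set"
  assumes "relatively_separated \<Lambda>"
  obtains N where "fibered_set \<Lambda> floor_vec N"
proof -
  define M :: "real ^ 'd \<Rightarrow> ennreal"
    where "M x = (\<Sum>\<^sub>\<infinity>l\<in>\<Lambda>. indicator ((+) l ` unit_cube) x)" for x
  have "(SUP x. M x) < \<infinity>"
    using assms by (simp add: relatively_separated_def M_def)
  then obtain N where N: "(SUP x. M x) < of_nat N"
    using ennreal_Ex_less_of_nat by auto
  \<comment> \<open>Finite subsets come first, since finiteness of the whole fiber is deduced from
    this bound.\<close>
  have card_le: "card F \<le> N" if F: "finite F" "F \<subseteq> {l \<in> \<Lambda>. floor_vec l = m}" for F m
  proof (cases "F = {}")
    case False
    \<comment> \<open>The coordinatewise maximum, which need not belong to \<open>F\<close>. Every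
      coordinate of it is attained by a point with the same floor as \<open>l\<close>, hence lies
      less than 1 above that of \<open>l\<close>.\<close>
    define x where "x = (\<chi> i. Max ((\<lambda>l. l $ i) ` F))"
    have mem: "x \<in> (+) l ` unit_cube" if l: "l \<in> F" for l
    proof -
      have "0 \<le> x $ i - l $ i \<and> x $ i - l $ i < 1" for i
      proof -
        have "l $ i \<le> x $ i" using F(1) l by (simp add: x_def)
        moreover have "x $ i \<in> (\<lambda>l. l $ i) ` F"
          using F(1) False by (simp add: x_def)
        then obtain l' where l': "l' \<in> F" "x $ i = l' $ i" by blast
        have "\<lfloor>l' $ i\<rfloor> = \<lfloor>l $ i\<rfloor>"
          using F(2) l l'(1) by (metis (mono_tags, lifting) floor_vec_nth mem_Collect_eq subsetD)
        ultimately show ?thesis using l'(2) by linarith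
      qed
      then show ?thesis unfolding mem_translated_cube_iff by (simp add: unit_cube_def)
    qed
    have "of_nat (card F) = (\<Sum>l\<in>F. indicator ((+) l ` unit_cube) x :: ennreal)"
      using mem by simp
    also have "\<dots> \<le> M x"
      unfolding M_def by (rule sum_le_infsum_ennreal) (use F in auto)
    also have "\<dots> \<le> (SUP x. M x)" by (rule SUP_upper) simp
    finally have "of_nat (card F) < (of_nat N :: ennreal)" using N by (rule le_less_trans)
    then show ?thesis by simp
  qed simp
  have "fibered_set \<Lambda> floor_vec N"
  proof
    fix m :: "int ^ 'd"
    show fin: "finite {l \<in> \<Lambda>. floor_vec l = m}"
    proof (rule ccontr)
      assume "infinite {l \<in> \<Lambda>. floor_vec l = m}"
      then obtain F where "F \<subseteq> {l \<in> \<Lambda>. floor_vec l = m}" "finite F" "card F = Suc N"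
        using infinite_arbitrarily_large by blast
      then show False using card_le[of F m] by simp
    qed
    show "card {l \<in> \<Lambda>. floor_vec l = m} \<le> N" by (rule card_le[OF fin subset_refl])
  qed
  then show thesis by (rule that)
qed

text \<open>The \<open>k\<close>-th term of the Sjostrand norm, indexed by integer vectors so that
  the index set becomes a whole type.\<close>

definition diagonal_sup :: "(real ^ 'd) set \<Rightarrow> (real ^ 'd \<Rightarrow> real ^ 'd \<Rightarrow> complex) \<Rightarrow> int ^ 'd \<Rightarrow> ennreal" where
  "diagonal_sup \<Lambda> a k = (SUP (l, l')\<in>\<Lambda> \<times> \<Lambda>.
     ennreal (norm (a l l')) * indicator ((+) (real_vec k) ` unit_cube) (l - l'))"

lemma sjostrand_norm_eq: "sjostrand_norm \<Lambda> a = (\<Sum>\<^sub>\<infinity>k. diagonal_sup \<Lambda> a k)"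
  unfolding sjostrand_norm_def diagonal_sup_def
  by (rule infsum_reindex_bij_betw[OF bij_betw_real_vec, symmetric])

section \<open>Domination and finiteness of the Sjostrand norm\<close>

context
  fixes \<Lambda> :: "(real ^ 'd) set" and N :: nat
  assumes fib: "fibered_set \<Lambda> floor_vec N"
begin

interpretation fibered_set \<Lambda> floor_vec N by (rule fib)

text \<open>If \<open>l - l'\<close> lies in the cube at \<open>k\<close>, the rounded points differ
  by \<open>k + e\<close> for a corner \<open>e\<close>. Hence finitely many translates of
  \<open>h\<close> together dominate the suprema.\<close>

lemma dominated_imp_sjostrand_norm_finite:
  assumes "dominated a h"
  shows "sjostrand_norm \<Lambda> a < \<infinity>"
proof -
  note h = dominatedD[OF assms]
  define H where "H k = (\<Sum>e\<in>unit_corners. h (k + e))" for k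
  have H0: "0 \<le> H k" for k unfolding H_def by (rule sum_nonneg) (rule h(1))
  have H: "H summable_on UNIV"
  proof -
    have "(\<lambda>k. h (k + e)) summable_on UNIV" for e
      using summable_on_reindex_bij_betw[OF bij_plus_left[of e], of h] h(2) by (simp add: add.commute)
    then show ?thesis
      unfolding H_def[abs_def] by (rule summable_on_sum[OF finite_unit_corners])
  qed
  have "diagonal_sup \<Lambda> a k \<le> ennreal (H k)" for k
    unfolding diagonal_sup_def
  proof (rule SUP_least, clarify)
    fix l l' assume l: "l \<in> \<Lambda>" "l' \<in> \<Lambda>"
    show "ennreal (norm (a l l')) * indicator ((+) (real_vec k) ` unit_cube) (l - l') \<le> ennreal (H k)"
    proof (cases "floor_vec (l - l') = k")
      case True
      define e where "e = floor_vec l - floor_vec l' - k"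
      have e: "e \<in> unit_corners" "floor_vec l - floor_vec l' = k + e"
        using floor_vec_diff[of l l'] True by (auto simp: e_def)
      have "norm (a l l') \<le> h (k + e)" using h(3)[OF l] e(2) by simp
      also have "\<dots> \<le> H k"
        unfolding H_def by (rule member_le_sum) (use e h(1) finite_unit_corners in auto)
      finally show ?thesis by (simp add: mem_lattice_cube_iff True ennreal_leI)
    qed (simp add: mem_lattice_cube_iff)
  qed
  then have "(\<Sum>\<^sub>\<infinity>k. diagonal_sup \<Lambda> a k) \<le> (\<Sum>\<^sub>\<infinity>k. ennreal (H k))"
    by (rule infsum_mono[rotated 2]) (auto intro: nonneg_summable_on_complete)
  also have "\<dots> \<le> ennreal (\<Sum>\<^sub>\<infinity>k. H k)"
  proof (rule infsum_le_finite_sums)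
    show "(\<Sum>k\<in>F. ennreal (H k)) \<le> ennreal (\<Sum>\<^sub>\<infinity>k. H k)" if "finite F" for F
      using H0 finite_sum_le_infsum[OF H that] by (simp add: sum_ennreal ennreal_leI)
  qed (auto intro: nonneg_summable_on_complete)
  finally show ?thesis by (auto simp: sjostrand_norm_eq le_less_trans)
qed

text \<open>A pair with rounded difference \<open>m\<close> has its true difference in a cube at
  \<open>m - e\<close> for some corner \<open>e\<close>, so adding the suprema over all these cubes
  gives a majorant.\<close>

lemma sjostrand_norm_finite_imp_dominated:
  assumes "sjostrand_norm \<Lambda> a < \<infinity>"
  shows "\<exists>h. dominated a h"
proof -
  define S where "S k = enn2real (diagonal_sup \<Lambda> a k)" for k
  have le: "(\<Sum>k\<in>F. diagonal_sup \<Lambda> a k) \<le> sjostrand_norm \<Lambda> a" if "finite F" for F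
    unfolding sjostrand_norm_eq by (rule sum_le_infsum_ennreal) (use that in auto)
  have "diagonal_sup \<Lambda> a k < \<infinity>" for k
    using le[of "{k}"] assms by (auto intro: le_less_trans)
  \<comment> \<open>Each supremum is finite, so nothing is lost in passing to real numbers.\<close>
  then have S: "ennreal (S k) = diagonal_sup \<Lambda> a k" for k by (simp add: S_def)
  have S0: "0 \<le> S k" for k by (simp add: S_def)
  have sm: "S summable_on UNIV"
  proof (rule nonneg_bdd_above_summable_on)
    show "bdd_above (sum S ` {F. F \<subseteq> UNIV \<and> finite F})"
    proof (rule bdd_aboveI2)
      fix F assume "F \<in> {F :: (int ^ 'd) set. F \<subseteq> UNIV \<and> finite F}"
      then have "ennreal (sum S F) \<le> sjostrand_norm \<Lambda> a"
        using le[of F] S0 by (simp add: sum_ennreal[symmetric] S)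
      then have "enn2real (ennreal (sum S F)) \<le> enn2real (sjostrand_norm \<Lambda> a)"
        using assms by (intro enn2real_mono) auto
      then show "sum S F \<le> enn2real (sjostrand_norm \<Lambda> a)" using S0 by (simp add: sum_nonneg)
    qed
  qed (use S0 in auto)
  define h where "h m = (\<Sum>e\<in>unit_corners. S (m - e))" for m
  have "(\<lambda>m. S (m - e)) summable_on UNIV" for e
    using summable_on_reindex_bij_betw[OF bij_plus_left[of "- e"], of S] sm by simp
  then have "h summable_on UNIV"
    unfolding h_def[abs_def] by (rule summable_on_sum[OF finite_unit_corners])
  moreover have "0 \<le> h m" for m unfolding h_def by (rule sum_nonneg) (rule S0)
  moreover have "norm (a l l') \<le> h (floor_vec l - floor_vec l')" if l: "l \<in> \<Lambda>" "l' \<in> \<Lambda>" for l l'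
  proof -
    define k where "k = floor_vec (l - l')"
    define e where "e = floor_vec l - floor_vec l' - k"
    have e: "e \<in> unit_corners" "k = floor_vec l - floor_vec l' - e"
      using floor_vec_diff[of l l'] by (auto simp: e_def k_def)
    have "ennreal (norm (a l l')) * indicator ((+) (real_vec k) ` unit_cube) (l - l') \<le> diagonal_sup \<Lambda> a k"
      unfolding diagonal_sup_def by (rule SUP_upper2[of "(l, l')"]) (use l in auto)
    then have "ennreal (norm (a l l')) \<le> ennreal (S k)"
      by (simp add: mem_lattice_cube_iff k_def S)
    then have "norm (a l l') \<le> S k" using S0 by (simp add: ennreal_le_iff)
    also have "\<dots> \<le> h (floor_vec l - floor_vec l')"
      unfolding h_def e(2) by (rule member_le_sum) (use e(1) S0 finite_unit_corners in auto)
    finally show ?thesis .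
  qed
  ultimately show ?thesis by (auto simp: dominated_def)
qed

text \<open>A dominated matrix may have nonzero entries outside
  \<open>\<Lambda> \<times> \<Lambda>\<close>; setting them to 0 puts it into the class without
  changing its operator.\<close>

lemma sjostrand_operators_eq:
  "sjostrand_operators p \<Lambda> = {matrix_operator p \<Lambda> a | a. \<exists>h. dominated a h}"
proof (intro equalityI subsetI)
  fix T assume "T \<in> sjostrand_operators p \<Lambda>"
  then show "T \<in> {matrix_operator p \<Lambda> a | a. \<exists>h. dominated a h}"
    using sjostrand_norm_finite_imp_dominated
    by (auto simp: sjostrand_operators_def sjostrand_class_def)
next
  fix T assume "T \<in> {matrix_operator p \<Lambda> a | a. \<exists>h. dominated a h}"
  then obtain a h where T: "T = matrix_operator p \<Lambda> a" and a: "dominated a h" by blast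
  define a' where "a' l l' = (if l \<in> \<Lambda> \<and> l' \<in> \<Lambda> then a l l' else 0)" for l l'
  have "dominated a' h" using a by (auto simp: dominated_def a'_def)
  then have "a' \<in> sjostrand_class \<Lambda>"
    using dominated_imp_sjostrand_norm_finite by (auto simp: sjostrand_class_def a'_def)
  moreover have "matrix_operator p \<Lambda> a' = T"
    unfolding T matrix_operator_def
    by (intro restrict_ext ext if_cong refl infsum_cong) (auto simp: a'_def)
  ultimately show "T \<in> sjostrand_operators p \<Lambda>" by (auto simp: sjostrand_operators_def)
qed

end

section \<open>The operator algebra\<close>

lemma bounded_operatorsD:
  assumes "T \<in> bounded_operators p \<Lambda>"
  shows "T \<in> extensional (lp_space p \<Lambda>)"
    and "c \<in> lp_space p \<Lambda> \<Longrightarrow> T c \<in> lp_space p \<Lambda>"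
    and "c \<in> lp_space p \<Lambda> \<Longrightarrow> c' \<in> lp_space p \<Lambda> \<Longrightarrow> T (\<lambda>x. c x + c' x) = (\<lambda>x. T c x + T c' x)"
    and "c \<in> lp_space p \<Lambda> \<Longrightarrow> T (\<lambda>x. z * c x) = (\<lambda>x. z * T c x)"
  using assms by (auto simp: bounded_operators_def PiE_def)

lemma bounded_operators_bound:
  assumes "1 \<le> p" "T \<in> bounded_operators p \<Lambda>"
  obtains K where "0 \<le> K" "\<And>c. c \<in> lp_space p \<Lambda> \<Longrightarrow> lp_norm p (T c) \<le> K * lp_norm p c"
proof -
  obtain K where K: "\<forall>c\<in>lp_space p \<Lambda>. lp_norm p (T c) \<le> K * lp_norm p c"
    using assms(2) unfolding bounded_operators_def by blast
  \<comment> \<open>The constant in the definition may be negative; its absolute value serves as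
    well.\<close>
  have "lp_norm p (T c) \<le> \<bar>K\<bar> * lp_norm p c" if "c \<in> lp_space p \<Lambda>" for c
    using bspec[OF K that] mult_right_mono[OF abs_ge_self lp_norm_nonneg[OF assms(1) that], of K] by simp
  then show thesis by (intro that[of "\<bar>K\<bar>"]) auto
qed

lemma bounded_operators_add:
  assumes p: "1 \<le> p" and S: "S \<in> bounded_operators p \<Lambda>" and T: "T \<in> bounded_operators p \<Lambda>"
  shows "(\<lambda>c\<in>lp_space p \<Lambda>. \<lambda>x. S c x + T c x) \<in> bounded_operators p \<Lambda>"
proof -
  note S' = bounded_operatorsD[OF S] and T' = bounded_operatorsD[OF T]
  obtain K where K: "0 \<le> K" "\<And>c. c \<in> lp_space p \<Lambda> \<Longrightarrow> lp_norm p (S c) \<le> K * lp_norm p c"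
    by (rule bounded_operators_bound[OF p S]) auto
  obtain L where L: "0 \<le> L" "\<And>c. c \<in> lp_space p \<Lambda> \<Longrightarrow> lp_norm p (T c) \<le> L * lp_norm p c"
    by (rule bounded_operators_bound[OF p T]) auto
  have "lp_norm p (\<lambda>x. S c x + T c x) \<le> (K + L) * lp_norm p c" if "c \<in> lp_space p \<Lambda>" for c
    using lp_space_add(2)[OF p S'(2)[OF that] T'(2)[OF that]] K(2)[OF that] L(2)[OF that]
    by (simp add: distrib_right)
  then show ?thesis
    by (auto simp: lp_space_add(1)[OF p] lp_space_scale(1)[OF p] bounded_operators_def S' T' distrib_left add_ac intro!: exI[of _ "K + L"])
qed

lemma bounded_operators_compose:
  assumes p: "1 \<le> p" and S: "S \<in> bounded_operators p \<Lambda>" and T: "T \<in> bounded_operators p \<Lambda>"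
  shows "compose (lp_space p \<Lambda>) S T \<in> bounded_operators p \<Lambda>"
proof -
  note S' = bounded_operatorsD[OF S] and T' = bounded_operatorsD[OF T]
  obtain K where K: "0 \<le> K" "\<And>c. c \<in> lp_space p \<Lambda> \<Longrightarrow> lp_norm p (S c) \<le> K * lp_norm p c"
    by (rule bounded_operators_bound[OF p S]) auto
  obtain L where L: "0 \<le> L" "\<And>c. c \<in> lp_space p \<Lambda> \<Longrightarrow> lp_norm p (T c) \<le> L * lp_norm p c"
    by (rule bounded_operators_bound[OF p T]) auto
  have "lp_norm p (S (T c)) \<le> (K * L) * lp_norm p c" if "c \<in> lp_space p \<Lambda>" for c
    using K(2)[OF T'(2)[OF that]] mult_left_mono[OF L(2)[OF that] K(1)] by (simp add: mult.assoc)
  then show ?thesis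
    by (auto simp: lp_space_add(1)[OF p] lp_space_scale(1)[OF p] bounded_operators_def compose_def S' T' intro!: exI[of _ "K * L"])
qed

section \<open>Dominated operators as an inverse-closed subalgebra\<close>

context
  fixes p :: ennreal and \<Lambda> :: "'a set" and g :: "'a \<Rightarrow> int ^ 'd" and N :: nat
  assumes p: "1 \<le> p" and fib: "fibered_set \<Lambda> g N"
begin

interpretation fibered_set \<Lambda> g N by (rule fib)

abbreviation (input) dominated_operators :: "(('a \<Rightarrow> complex) \<Rightarrow> 'a \<Rightarrow> complex) set" where
  "dominated_operators \<equiv> {matrix_operator p \<Lambda> a | a. \<exists>h. dominated a h}"

lemma dominated_operators_subset: "dominated_operators \<subseteq> bounded_operators p \<Lambda>"
  using matrix_operator_bounded[OF p] by blast

lemma one_dominated_operator: "(\<lambda>c\<in>lp_space p \<Lambda>. c) \<in> dominated_operators"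
  unfolding matrix_operator_identity[symmetric] using dominated_identity by blast

lemma scale_dominated_operator:
  assumes "T \<in> dominated_operators"
  shows "(\<lambda>c\<in>lp_space p \<Lambda>. \<lambda>x. z * T c x) \<in> dominated_operators"
proof -
  from assms obtain a h where T: "T = matrix_operator p \<Lambda> a" and a: "dominated a h" by blast
  have "(\<lambda>c\<in>lp_space p \<Lambda>. \<lambda>x. z * T c x) = matrix_operator p \<Lambda> (\<lambda>x y. z * a x y)"
    by (rule extensionalityI[of _ "lp_space p \<Lambda>"])
      (simp_all add: T matrix_operator_scale, simp add: matrix_operator_def)
  then show ?thesis using dominated_scale[OF a] by blast
qed

lemma zero_dominated_operator: "(\<lambda>c\<in>lp_space p \<Lambda>. \<lambda>x. 0) \<in> dominated_operators"
  using scale_dominated_operator[OF one_dominated_operator, of 0] by simp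

lemma add_dominated_operator:
  assumes "S \<in> dominated_operators" "T \<in> dominated_operators"
  shows "(\<lambda>c\<in>lp_space p \<Lambda>. \<lambda>x. S c x + T c x) \<in> dominated_operators"
proof -
  from assms obtain a h b h' where ab: "S = matrix_operator p \<Lambda> a" "dominated a h"
    "T = matrix_operator p \<Lambda> b" "dominated b h'" by blast
  have "(\<lambda>c\<in>lp_space p \<Lambda>. \<lambda>x. S c x + T c x) = matrix_operator p \<Lambda> (\<lambda>x y. a x y + b x y)"
    by (rule extensionalityI[of _ "lp_space p \<Lambda>"])
      (simp_all add: ab matrix_operator_add[OF p ab(2,4)], simp add: matrix_operator_def)
  then show ?thesis using dominated_add[OF ab(2,4)] by blast
qed

lemma mult_dominated_operator:
  assumes "S \<in> dominated_operators" "T \<in> dominated_operators"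
  shows "compose (lp_space p \<Lambda>) S T \<in> dominated_operators"
proof -
  from assms obtain a h b h' where ab: "S = matrix_operator p \<Lambda> a" "dominated a h"
    "T = matrix_operator p \<Lambda> b" "dominated b h'" by blast
  have "compose (lp_space p \<Lambda>) S T = matrix_operator p \<Lambda> (matrix_mult a b)"
    by (rule extensionalityI[of _ "lp_space p \<Lambda>"])
      (simp_all add: ab compose_def matrix_operator_mult[OF p ab(2,4)], simp add: matrix_operator_def)
  then show ?thesis using dominated_mult[OF ab(2,4)] by blast
qed

lemma zero_operator_bounded: "(\<lambda>c\<in>lp_space p \<Lambda>. \<lambda>x. 0) \<in> bounded_operators p \<Lambda>"
  and one_operator_bounded: "(\<lambda>c\<in>lp_space p \<Lambda>. c) \<in> bounded_operators p \<Lambda>"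
  using zero_dominated_operator one_dominated_operator dominated_operators_subset by blast+

lemma monoid_operator_algebra: "monoid (operator_algebra p \<Lambda>)"
proof (rule monoidI)
  fix R S T
  assume *: "R \<in> carrier (operator_algebra p \<Lambda>)" "S \<in> carrier (operator_algebra p \<Lambda>)"
    "T \<in> carrier (operator_algebra p \<Lambda>)"
  then show "R \<otimes>\<^bsub>operator_algebra p \<Lambda>\<^esub> S \<in> carrier (operator_algebra p \<Lambda>)"
    using bounded_operators_compose[OF p] by (simp add: operator_algebra_def)
  show "R \<otimes>\<^bsub>operator_algebra p \<Lambda>\<^esub> S \<otimes>\<^bsub>operator_algebra p \<Lambda>\<^esub> T =
      R \<otimes>\<^bsub>operator_algebra p \<Lambda>\<^esub> (S \<otimes>\<^bsub>operator_algebra p \<Lambda>\<^esub> T)"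
    using * bounded_operatorsD(2) by (auto simp: operator_algebra_def compose_def fun_eq_iff)
  show "\<one>\<^bsub>operator_algebra p \<Lambda>\<^esub> \<otimes>\<^bsub>operator_algebra p \<Lambda>\<^esub> R = R"
    using * bounded_operatorsD(1,2)[of R]
    by (auto simp: operator_algebra_def compose_def fun_eq_iff extensional_def)
  show "R \<otimes>\<^bsub>operator_algebra p \<Lambda>\<^esub> \<one>\<^bsub>operator_algebra p \<Lambda>\<^esub> = R"
    using * bounded_operatorsD(1,2)[of R]
    by (auto simp: operator_algebra_def compose_def fun_eq_iff extensional_def)
qed (use one_operator_bounded in \<open>simp add: operator_algebra_def\<close>)

lemma monoid_add_operator_algebra: "monoid (add_monoid (operator_algebra p \<Lambda>))"
proof (rule monoidI)
  fix R S T
  assume *: "R \<in> carrier (add_monoid (operator_algebra p \<Lambda>))"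
    "S \<in> carrier (add_monoid (operator_algebra p \<Lambda>))"
    "T \<in> carrier (add_monoid (operator_algebra p \<Lambda>))"
  then show "R \<otimes>\<^bsub>add_monoid (operator_algebra p \<Lambda>)\<^esub> S \<in> carrier (add_monoid (operator_algebra p \<Lambda>))"
    using bounded_operators_add[OF p] by (simp add: operator_algebra_def)
  show "R \<otimes>\<^bsub>add_monoid (operator_algebra p \<Lambda>)\<^esub> S \<otimes>\<^bsub>add_monoid (operator_algebra p \<Lambda>)\<^esub> T =
      R \<otimes>\<^bsub>add_monoid (operator_algebra p \<Lambda>)\<^esub> (S \<otimes>\<^bsub>add_monoid (operator_algebra p \<Lambda>)\<^esub> T)"
    by (auto simp: operator_algebra_def fun_eq_iff add.assoc)
  show "\<one>\<^bsub>add_monoid (operator_algebra p \<Lambda>)\<^esub> \<otimes>\<^bsub>add_monoid (operator_algebra p \<Lambda>)\<^esub> R = R"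
    using * bounded_operatorsD(1)[of R]
    by (auto simp: operator_algebra_def fun_eq_iff extensional_def)
  show "R \<otimes>\<^bsub>add_monoid (operator_algebra p \<Lambda>)\<^esub> \<one>\<^bsub>add_monoid (operator_algebra p \<Lambda>)\<^esub> = R"
    using * bounded_operatorsD(1)[of R]
    by (auto simp: operator_algebra_def fun_eq_iff extensional_def)
qed (use zero_operator_bounded in \<open>simp add: operator_algebra_def\<close>)

lemma is_subalgebra_dominated_operators: "is_subalgebra dominated_operators (operator_algebra p \<Lambda>)"
proof -
  let ?B = "operator_algebra p \<Lambda>"
  have neg: "inv\<^bsub>add_monoid ?B\<^esub> T \<in> dominated_operators" if T: "T \<in> dominated_operators" for T
  proof -
    let ?T = "\<lambda>c\<in>lp_space p \<Lambda>. \<lambda>x. - 1 * T c x"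
    have mem: "?T \<in> dominated_operators" by (rule scale_dominated_operator[OF T])
    have "inv\<^bsub>add_monoid ?B\<^esub> T = ?T"
    \<comment> \<open>Two-sided inverses in a monoid are unique, so the abstract additive inverse is
      found by exhibiting \<open>-T\<close>.\<close>
    proof (rule monoid.inv_char[OF monoid_add_operator_algebra])
      show "T \<in> carrier (add_monoid ?B)" "?T \<in> carrier (add_monoid ?B)"
        using subsetD[OF dominated_operators_subset T] subsetD[OF dominated_operators_subset mem]
        by (simp_all add: operator_algebra_def)
    qed (auto simp: operator_algebra_def fun_eq_iff)
    then show ?thesis using mem by simp
  qed
  have "subgroup dominated_operators (add_monoid ?B)"
  proof (rule subgroup.intro)
    show "dominated_operators \<subseteq> carrier (add_monoid ?B)"
      using dominated_operators_subset by (simp add: operator_algebra_def)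
    show "S \<otimes>\<^bsub>add_monoid ?B\<^esub> T \<in> dominated_operators"
      if "S \<in> dominated_operators" "T \<in> dominated_operators" for S T
      using add_dominated_operator[OF that] by (simp add: operator_algebra_def)
    show "\<one>\<^bsub>add_monoid ?B\<^esub> \<in> dominated_operators"
      using zero_dominated_operator by (simp add: operator_algebra_def)
  qed (rule neg)
  moreover have "submonoid dominated_operators ?B"
  proof (rule submonoid.intro)
    show "dominated_operators \<subseteq> carrier ?B"
      using dominated_operators_subset by (simp add: operator_algebra_def)
    show "S \<otimes>\<^bsub>?B\<^esub> T \<in> dominated_operators"
      if "S \<in> dominated_operators" "T \<in> dominated_operators" for S T
      using mult_dominated_operator[OF that] by (simp add: operator_algebra_def)
    show "\<one>\<^bsub>?B\<^esub> \<in> dominated_operators"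
      using one_dominated_operator by (simp add: operator_algebra_def)
  qed
  moreover have "z \<odot>\<^bsub>?B\<^esub> T \<in> dominated_operators" if "T \<in> dominated_operators" for z T
    using scale_dominated_operator[OF that] by (simp add: operator_algebra_def)
  ultimately show ?thesis unfolding is_subalgebra_def subring_def by blast
qed

text \<open>The images of the unit vectors under the inverse form a matrix \<open>b\<close>, which
  is dominated by \<open>inverse_dominated\<close>. It remains to see that the inverse is the
  operator of \<open>b\<close>.\<close>

lemma inverse_closed_dominated_operators: "inverse_closed dominated_operators (operator_algebra p \<Lambda>)"
  unfolding inverse_closed_def
proof (intro ballI impI)
  let ?B = "operator_algebra p \<Lambda>"
  interpret B: monoid ?B by (rule monoid_operator_algebra)
  fix T assume "T \<in> dominated_operators" and unit: "T \<in> Units ?B"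
  then obtain a h where T: "T = matrix_operator p \<Lambda> a" and a: "dominated a h" by blast
  define S where "S = inv\<^bsub>?B\<^esub> T"
  have S: "S \<in> bounded_operators p \<Lambda>"
    using B.Units_inv_closed[OF unit] by (simp add: S_def operator_algebra_def)
  note S' = bounded_operatorsD[OF S]
  have ST: "S (T c) = c" and TS: "T (S c) = c" if "c \<in> lp_space p \<Lambda>" for c
    using that fun_cong[OF B.Units_l_inv[OF unit], of c] fun_cong[OF B.Units_r_inv[OF unit], of c]
    by (simp_all add: S_def operator_algebra_def compose_def)
  obtain K where K: "0 \<le> K" "\<And>c. c \<in> lp_space p \<Lambda> \<Longrightarrow> lp_norm p (S c) \<le> K * lp_norm p c"
    by (rule bounded_operators_bound[OF p S]) auto
  define b where "b x y = S (unit_vector y) x" for x y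
  have b: "(\<lambda>x. b x y) \<in> lp_space p \<Lambda>" "matrix_operator p \<Lambda> a (\<lambda>x. b x y) = unit_vector y"
    if "y \<in> \<Lambda>" for y
    using S'(2)[OF unit_vector_lp(1)[OF p that]] TS[OF unit_vector_lp(1)[OF p that]]
    by (simp_all add: b_def T)
  have inv_bound: "lp_norm p c \<le> K * lp_norm p (matrix_operator p \<Lambda> a c)" if "c \<in> lp_space p \<Lambda>" for c
    using K(2)[OF dominated_apply(3)[OF p a that]] ST[OF that] by (simp add: T)
  obtain h' where h': "dominated b h'"
    using inverse_dominated[OF fib p a K(1) inv_bound b] by blast
  have "matrix_mult a b x z = identity_matrix x z" for x z
  proof (cases "x \<in> \<Lambda> \<and> z \<in> \<Lambda>")
    case True
    then show ?thesis
      using fun_cong[OF b(2)[of z], of x] b(1)[of z]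
      by (simp add: matrix_operator_def matrix_mult_def identity_matrix_def unit_vector_def)
  qed (auto simp: matrix_mult_def identity_matrix_def)
  then have ab: "matrix_mult a b = identity_matrix" by blast
  \<comment> \<open>For \<open>p = \<infinity>\<close> a bounded operator need not be determined by
    its values on unit vectors. Instead, the matrix identity \<open>ab\<close> shows that
    \<open>b\<close> induces a right inverse of \<open>T\<close>, and applying \<open>S\<close> on
    the left identifies it with \<open>S\<close>.\<close>
  have "S = matrix_operator p \<Lambda> b"
  proof (rule extensionalityI[OF S'(1)])
    show "matrix_operator p \<Lambda> b \<in> extensional (lp_space p \<Lambda>)" by (simp add: matrix_operator_def)
    fix c assume c: "c \<in> lp_space p \<Lambda>"
    have "matrix_operator p \<Lambda> b c = S (T (matrix_operator p \<Lambda> b c))"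
      using ST[OF dominated_apply(3)[OF p h' c]] by simp
    also have "T (matrix_operator p \<Lambda> b c) = c"
      unfolding T matrix_operator_mult[OF p a h' c] ab matrix_operator_identity using c by simp
    finally show "S c = matrix_operator p \<Lambda> b c" by simp
  qed
  then show "inv\<^bsub>?B\<^esub> T \<in> dominated_operators" using h' unfolding S_def by blast
qed

end

theorem corollary2p4:
  fixes p :: ennreal and \<Lambda> :: "(real ^ 'd) set"
  assumes "1 \<le> p" and "relatively_separated \<Lambda>"
  shows "is_subalgebra (sjostrand_operators p \<Lambda>) (operator_algebra p \<Lambda>) \<and>
         inverse_closed (sjostrand_operators p \<Lambda>) (operator_algebra p \<Lambda>)"
proof -
  obtain N where N: "fibered_set \<Lambda> floor_vec N"
    using relatively_separated_fibered[OF assms(2)] .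
  show ?thesis
    unfolding sjostrand_operators_eq[OF N]
    using is_subalgebra_dominated_operators[OF assms(1) N]
      inverse_closed_dominated_operators[OF assms(1) N] by blast
qed

end
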